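(* Assume $n_-(T_{\min})\le n_+(T_{\min})$. Let $m_0(\lambda)$, $M_{2+}(\lambda)$, $M_{3+}(\lambda)$, $M_{4+}(\lambda)$ be the operator functions $$m_0(\lambda)=(\Gamma_{0a}+\hat\Gamma_a)v_0(\lambda)+\tfrac i2P_{\hat H}\ (\lambda\in\mathbb C\setminus\mathbb R),\quad M_{2+}(\lambda)=(\Gamma_{0a}+\hat\Gamma_a)u_+(\lambda),$$ $$M_{3+}(\lambda)=-\Gamma_{1b}v_0(\lambda),\quad M_{4+}(\lambda)=-\Gamma_{1b}u_+(\lambda)\quad(\lambda\in\mathbb C_+),$$ where $v_0,u_+$ are the operator solutions of $(E_\lambda)$ described in the context. Let $\tau_0=\{\tau_+,\tau_-\}\in\widetilde R(\widetilde{\mathcal H}_b,\mathcal H_b)$ be the boundary parameter given by $C_0(\lambda)\equiv I_{\widetilde{\mathcal H}_b}$, $C_1(\lambda)\equiv0$, $D_0(\lambda)\equiv P_{\mathcal H_b}\in[\widetilde{\mathcal H}_b,\mathcal H_b]$, $D_1(\lambda)\equiv0$. Then $m_0(\lambda)=m_{\tau_0}(\lambda)$, and for every boundary parameter $\tau=\{\tau_+,\tau_-\}\in\widetilde R(\widetilde{\mathcal H}_b,\mathcal H_b)$, $\tau_+=\{(C_0,C_1);\widetilde{\mathcal H}_b\}$, $\tau_-=\{(D_0,D_1);\mathcal H_b\}$, the corresponding $m$-function $m_\tau(\cdot)$ is of the form $$m_\tau(\lambda)=m_0(\lambda)+M_{2+}(\lambda)\big(C_0(\lambda)-C_1(\lambda)M_{4+}(\lambda)\big)^{-1}C_1(\lambda)M_{3+}(\lambda),\quad\lambda\in\mathbb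 C_+.$$
   Context: Setting. $[X,Y]$ is the set of bounded linear operators $X\to Y$, $[X]=[X,X]$, $\operatorname{Im}A=(A-A^* )/(2i)$; $0\in\rho(A)$ means $A$ is boundedly invertible. $H,\hat H$ are finite-dimensional complex Hilbert spaces, $H_0=H\oplus\hat H$, $\mathbb H=H\oplus\hat H\oplus H=H_0\oplus H$; $P_H,P_{\hat H}$ are the orthoprojections of $H_0$ onto $H,\hat H$. $\mathcal I=[a,b\rangle$ is an interval, $-\infty<a<b\le\infty$ (if finite, $b$ may or may not belong to $\mathcal I$). $B,\Delta:\mathcal I\to[\mathbb H]$ are Borel, norm-integrable over every $[a,\beta]\subset\mathcal I$, with $B(t)=B(t)^*$, $\Delta(t)\ge0$ a.e., and $J=\begin{pmatrix}0&0&-I_H\\ 0&iI_{\hat H}&0\\ I_H&0&0\end{pmatrix}$. The system is $Jy'-By=\Delta f$, with homogeneous equation $(E_\lambda)$: $Jy'-By=\lambda\Delta y$; solutions lie in $AC(\mathcal I;\mathbb H)$ (functions absolutely continuous on each $[a,\beta]\subset\mathcal I$). It is assumed definite: for every $\lambda\in\mathbb C$, a solution $y$ of $(E_\lambda)$ with $\Delta y=0$ a.e. is identically zero. $\mathcal L^2_\Delta(\mathcal I)$ is the space of Borel $f:\mathcal I\to\mathbb H$ with $\|f\|^2_\Delta=\int_{\mathcal I}(\Delta f,f)\,dt<\infty$; $L^2_\Delta(\mathcal I)$ is the quotient Hilbert space by $\{\|f\|_\Delta=0\}$, $\pi$ the quotient map. For finite-dimensional $K$, $\mathcal L^2_\Delta[K,\mathbb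 H]$ is the set of Borel $F:\mathcal I\to[K,\mathbb H]$ with $F(\cdot)h\in\mathcal L^2_\Delta(\mathcal I)$ for all $h\in K$. An operator solution of $(E_\lambda)$ is $Y(\cdot,\lambda):\mathcal I\to[K,\mathbb H]$ such that $Y(\cdot,\lambda)h$ solves $(E_\lambda)$ for all $h\in K$; if it lies in $\mathcal L^2_\Delta[K,\mathbb H]$, $Y(\lambda)$ denotes the map $h\mapsto Y(\cdot,\lambda)h\in\operatorname{dom}\mathcal T_{\max}$. Relations. $\mathcal T_{\max}=\{\{y,f\}\in\mathcal L^2_\Delta(\mathcal I)^2: y\in AC(\mathcal I;\mathbb H),\ Jy'-By=\Delta f\text{ a.e.}\}$, $T_{\max}=\{\{\pi y,\pi f\}:\{y,f\}\in\mathcal T_{\max}\}$; $[y,z]_b=\lim_{t\uparrow b}(Jy(t),z(t))$ for $y,z\in\operatorname{dom}\mathcal T_{\max}$; $T_{\min}=\{\{\pi y,\pi f\}:\{y,f\}\in\mathcal T_{\max},\ y(a)=0,\ [y,z]_b=0\ \forall z\in\operatorname{dom}\mathcal T_{\max}\}$ is closed symmetric with $T_{\min}^*=T_{\max}$; $n_\pm(T_{\min})=\dim\ker(T_{\max}-\lambda)$, $\lambda\in\mathbb C_\pm$. Boundary maps at $a$. $U=\begin{pmatrix}u_1&u_2&u_3\\ u_4&u_5&u_6\end{pmatrix}:H\oplus\hat H\oplus H\to\hat H\oplus H$ is surjective with $iu_2u_2^*-u_1u_3^*+u_3u_1^*=iI_{\hat H}$, $iu_5u_2^*-u_4u_3^*+u_6u_1^*=0$,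 $iu_5u_5^*+u_6u_4^*-u_4u_6^*=0$; $\widetilde U=\begin{pmatrix}u_7&u_8&u_9\\ u_1&u_2&u_3\\ u_4&u_5&u_6\end{pmatrix}$ is an extension of $U$ with $\widetilde U^*J\widetilde U=J$. For $y\in AC(\mathcal I;\mathbb H)$, $(\Gamma_{0a}y,\hat\Gamma_ay,\Gamma_{1a}y)^\top=\widetilde Uy(a)\in H\oplus\hat H\oplus H$; $\Gamma_{0a}+\hat\Gamma_a$ maps into $H\oplus\hat H=H_0$. Boundary maps at $b$. $\widetilde{\mathcal H}_b$ is a finite-dimensional Hilbert space, $\mathcal H_b\subset\widetilde{\mathcal H}_b$ a subspace, $\mathcal H_b^\perp=\widetilde{\mathcal H}_b\ominus\mathcal H_b$, and $\Gamma_b=(\Gamma_{0b},\hat\Gamma_b,\Gamma_{1b})^\top:\operatorname{dom}\mathcal T_{\max}\to\widetilde{\mathcal H}_b\oplus\hat H\oplus\mathcal H_b$ is a fixed surjective linear map with $[y,z]_b=(\Gamma_{0b}y,\Gamma_{1b}z)-(\Gamma_{1b}y,\Gamma_{0b}z)+i(P_{\mathcal H_b^\perp}\Gamma_{0b}y,P_{\mathcal H_b^\perp}\Gamma_{0b}z)+i(\hat\Gamma_by,\hat\Gamma_bz)$ (it exists when $n_-(T_{\min})\le n_+(T_{\min})$). Boundary parameters. $\widetilde R(\widetilde{\mathcal H}_b,\mathcal H_b)$ consists of collections $\tau=\{\tau_+,\tau_-\}$, $\tau_+(\lambda)=\{(C_0(\lambda),C_1(\lambda));\widetilde{\mathcal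 H}_b\}$ ($\lambda\in\mathbb C_+$), $\tau_-(\lambda)=\{(D_0(\lambda),D_1(\lambda));\mathcal H_b\}$ ($\lambda\in\mathbb C_-$), of holomorphic $C_0:\mathbb C_+\to[\widetilde{\mathcal H}_b]$, $C_1:\mathbb C_+\to[\mathcal H_b,\widetilde{\mathcal H}_b]$, $D_0:\mathbb C_-\to[\widetilde{\mathcal H}_b,\mathcal H_b]$, $D_1:\mathbb C_-\to[\mathcal H_b]$ such that, with $C_0=(C_{01},C_{02})$, $D_0=(D_{01},D_{02})$ on $\widetilde{\mathcal H}_b=\mathcal H_b\oplus\mathcal H_b^\perp$: $2\operatorname{Im}(C_1C_{01}^* )+C_{02}C_{02}^*\ge0$ on $\mathbb C_+$; $2\operatorname{Im}(D_1D_{01}^* )+D_{02}D_{02}^*\le0$ on $\mathbb C_-$; $C_1(\lambda)D_{01}^*(\bar\lambda)-C_{01}(\lambda)D_1^*(\bar\lambda)+iC_{02}(\lambda)D_{02}^*(\bar\lambda)=0$, $\lambda\in\mathbb C_+$; $0\in\rho(C_0-iC_1P_{\mathcal H_b})$ on $\mathbb C_+$; $0\in\rho(D_{01}+iD_1)$ on $\mathbb C_-$ (pairs differing by left multiplication by a holomorphic invertible-operator-valued function are identified). Solutions. $v_0(\cdot,\lambda)\in\mathcal L^2_\Delta[H_0,\mathbb H]$ ($\lambda\in\mathbb C\setminus\mathbb R$) is the unique operator solution of $(E_\lambda)$ with $\Gamma_{1a}v_0(\lambda)=-P_H$, $i(\hat\Gamma_a-\hat\Gamma_b)v_0(\lambda)=P_{\hat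 H}$, and $\Gamma_{0b}v_0(\lambda)=0$ for $\lambda\in\mathbb C_+$, $P_{\mathcal H_b}\Gamma_{0b}v_0(\lambda)=0$ for $\lambda\in\mathbb C_-$. $u_+(\cdot,\lambda)\in\mathcal L^2_\Delta[\widetilde{\mathcal H}_b,\mathbb H]$ ($\lambda\in\mathbb C_+$) is the unique operator solution with $\Gamma_{1a}u_+(\lambda)=0$, $i(\hat\Gamma_a-\hat\Gamma_b)u_+(\lambda)=0$, $\Gamma_{0b}u_+(\lambda)=I_{\widetilde{\mathcal H}_b}$. $m$-function. $v_\tau(\cdot,\lambda)\in\mathcal L^2_\Delta[H_0,\mathbb H]$ ($\lambda\in\mathbb C\setminus\mathbb R$) is the unique operator solution of $(E_\lambda)$ with $\Gamma_{1a}v_\tau(\lambda)=-P_H$, $i(\hat\Gamma_a-\hat\Gamma_b)v_\tau(\lambda)=P_{\hat H}$, $C_0(\lambda)\Gamma_{0b}v_\tau(\lambda)+C_1(\lambda)\Gamma_{1b}v_\tau(\lambda)=0$ for $\lambda\in\mathbb C_+$ and $D_0(\lambda)\Gamma_{0b}v_\tau(\lambda)+D_1(\lambda)\Gamma_{1b}v_\tau(\lambda)=0$ for $\lambda\in\mathbb C_-$. The $m$-function is $m_\tau(\lambda)=(\Gamma_{0a}+\hat\Gamma_a)v_\tau(\lambda)+\frac i2P_{\hat H}\in[H_0]$. *)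

theory Defs
  imports "HOL-Analysis.Analysis" "HOL-Library.Extended_Nat"
begin

section \<open>Finite-dimensional complex Hilbert spaces\<close>

text \<open>
  The class \<open>euclidean_space\<close> excludes the zero space, which has to be allowed here (for instance
  \<open>H_hat = {0}\<close>, the Hamiltonian case). The inner product \<open>cinner\<close> is linear in its first argument, and
  the topology is the one of \<open>real_inner\<close> for the inner product \<open>Re (cinner x y)\<close>.
\<close>

class fd_chilbert = real_inner +
  fixes scaleC :: "complex \<Rightarrow> 'a \<Rightarrow> 'a"  (infixr "*\<^sub>C" 75)
    and cinner :: "'a \<Rightarrow> 'a \<Rightarrow> complex"
  assumes scaleC_add_right: "c *\<^sub>C (x + y) = c *\<^sub>C x + c *\<^sub>C y"
    and scaleC_add_left: "(c + d) *\<^sub>C x = c *\<^sub>C x + d *\<^sub>C x"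
    and scaleC_scaleC: "c *\<^sub>C (d *\<^sub>C x) = (c * d) *\<^sub>C x"
    and scaleR_scaleC: "r *\<^sub>R x = complex_of_real r *\<^sub>C x"
    and cinner_commute: "cinner x y = cnj (cinner y x)"
    and cinner_add_left: "cinner (x + y) z = cinner x z + cinner y z"
    and cinner_scaleC_left: "cinner (c *\<^sub>C x) y = c * cinner x y"
    and inner_eq_Re_cinner: "inner x y = Re (cinner x y)"
    and finite_dimensional: "\<exists>B. finite B \<and> (\<forall>x. \<exists>c. x = (\<Sum>b\<in>B. c b *\<^sub>C b))"

text \<open>The orthogonal sum of two spaces is their product type.\<close>

instantiation prod :: (fd_chilbert, fd_chilbert) fd_chilbert
begin

definition scaleC_prod :: "complex \<Rightarrow> 'a \<times> 'b \<Rightarrow> 'a \<times> 'b" where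
  "scaleC_prod c x = (c *\<^sub>C fst x, c *\<^sub>C snd x)"

definition cinner_prod :: "'a \<times> 'b \<Rightarrow> 'a \<times> 'b \<Rightarrow> complex" where
  "cinner_prod x y = cinner (fst x) (fst y) + cinner (snd x) (snd y)"

instance
proof
  show "\<exists>B::('a \<times> 'b) set. finite B \<and> (\<forall>x. \<exists>c. x = (\<Sum>b\<in>B. c b *\<^sub>C b))"
  proof -
    obtain B1 :: "'a set" where B1: "finite B1" "\<And>x. \<exists>c. x = (\<Sum>b\<in>B1. c b *\<^sub>C b)"
      using finite_dimensional by blast
    obtain B2 :: "'b set" where B2: "finite B2" "\<And>x. \<exists>c. x = (\<Sum>b\<in>B2. c b *\<^sub>C b)"
      using finite_dimensional by blast
    have z1: "c *\<^sub>C (0::'a) = 0" for c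
      using scaleC_add_right[of c "0::'a" 0] by simp
    have z2: "c *\<^sub>C (0::'b) = 0" for c
      using scaleC_add_right[of c "0::'b" 0] by simp
    define L where "L = (\<lambda>b. (b, 0::'b)) ` B1"
    define R where "R = (\<lambda>b. (0::'a, b)) ` (B2 - {0})"
    have fin: "finite L" "finite R" and disj: "L \<inter> R = {}"
      using B1(1) B2(1) by (auto simp: L_def R_def)
    have "\<exists>c. x = (\<Sum>b\<in>L \<union> R. c b *\<^sub>C b)" for x :: "'a \<times> 'b"
    proof -
      obtain c1 where c1: "fst x = (\<Sum>b\<in>B1. c1 b *\<^sub>C b)" using B1(2) by blast
      obtain c2 where c2: "snd x = (\<Sum>b\<in>B2. c2 b *\<^sub>C b)" using B2(2) by blast
      define c where "c = (\<lambda>b. if b \<in> L then c1 (fst b) else c2 (snd b))"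
      have "(\<Sum>b\<in>L. c b *\<^sub>C b) = (\<Sum>b\<in>L. c1 (fst b) *\<^sub>C b)"
        by (rule sum.cong) (auto simp: c_def)
      also have "\<dots> = (\<Sum>b\<in>B1. c1 b *\<^sub>C (b, 0))"
        unfolding L_def by (subst sum.reindex) (auto simp: inj_on_def)
      also have "\<dots> = (\<Sum>b\<in>B1. (c1 b *\<^sub>C b, 0))"
        by (simp add: scaleC_prod_def z2)
      finally have sL: "(\<Sum>b\<in>L. c b *\<^sub>C b) = (fst x, 0)"
        by (simp add: c1 sum_prod prod_eq_iff fst_sum snd_sum)
      have "(\<Sum>b\<in>R. c b *\<^sub>C b) = (\<Sum>b\<in>R. c2 (snd b) *\<^sub>C b)"
        using disj by (intro sum.cong) (auto simp: c_def)
      also have "\<dots> = (\<Sum>b\<in>B2 - {0}. c2 b *\<^sub>C (0, b))"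
        unfolding R_def by (subst sum.reindex) (auto simp: inj_on_def)
      also have "\<dots> = (\<Sum>b\<in>B2 - {0}. (0, c2 b *\<^sub>C b))"
        by (simp add: scaleC_prod_def z1)
      also have "\<dots> = (0, \<Sum>b\<in>B2 - {0}. c2 b *\<^sub>C b)"
        by (simp add: prod_eq_iff fst_sum snd_sum)
      also have "(\<Sum>b\<in>B2 - {0}. c2 b *\<^sub>C b) = (\<Sum>b\<in>B2. c2 b *\<^sub>C b)"
        using B2(1) by (intro sum.mono_neutral_left) (auto simp: z2)
      finally have sR: "(\<Sum>b\<in>R. c b *\<^sub>C b) = (0, snd x)"
        by (simp add: c2)
      have "x = (\<Sum>b\<in>L \<union> R. c b *\<^sub>C b)"
        by (simp add: sum.union_disjoint[OF fin disj] sL sR)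
      then show ?thesis by blast
    qed
    with fin show ?thesis by (intro exI[of _ "L \<union> R"]) auto
  qed
next
  fix x y :: "'a \<times> 'b"
  show "cinner x y = cnj (cinner y x)"
    using cinner_commute[of "fst x" "fst y"] cinner_commute[of "snd x" "snd y"]
    by (simp add: cinner_prod_def)
qed (auto simp: scaleC_prod_def cinner_prod_def scaleC_add_right scaleC_add_left scaleC_scaleC
      scaleR_scaleC cinner_add_left cinner_scaleC_left inner_eq_Re_cinner prod_eq_iff
      algebra_simps inner_prod_def)

end


section \<open>Subspaces and operators\<close>

text \<open>
  An operator in \<open>[X, Y]\<close>, for subspaces \<open>X\<close> and \<open>Y\<close>, is a function that matters only on \<open>X\<close>.
  Boundedness is automatic in finite dimensions.
\<close>

definition csubspace :: "'a::fd_chilbert set \<Rightarrow> bool" where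
  "csubspace X \<longleftrightarrow> 0 \<in> X \<and> (\<forall>x\<in>X. \<forall>y\<in>X. x + y \<in> X) \<and> (\<forall>c. \<forall>x\<in>X. c *\<^sub>C x \<in> X)"

definition operators :: "'a::fd_chilbert set \<Rightarrow> 'b::fd_chilbert set \<Rightarrow> ('a \<Rightarrow> 'b) set" where
  "operators X Y = {A. (\<forall>x\<in>X. A x \<in> Y) \<and> (\<forall>x\<in>X. \<forall>y\<in>X. A (x + y) = A x + A y)
     \<and> (\<forall>c. \<forall>x\<in>X. A (c *\<^sub>C x) = c *\<^sub>C A x)}"

definition cadj :: "'a::fd_chilbert set \<Rightarrow> 'b::fd_chilbert set \<Rightarrow> ('a \<Rightarrow> 'b) \<Rightarrow> 'b \<Rightarrow> 'a" where
  "cadj X Y A y = (THE z. z \<in> X \<and> (\<forall>x\<in>X. cinner (A x) y = cinner x z))"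

definition op_Im :: "'a::fd_chilbert set \<Rightarrow> ('a \<Rightarrow> 'a) \<Rightarrow> 'a \<Rightarrow> 'a" where
  "op_Im X A = (\<lambda>x. (1 / (2 * \<i>)) *\<^sub>C (A x - cadj X X A x))"

definition op_nonneg :: "'a::fd_chilbert set \<Rightarrow> ('a \<Rightarrow> 'a) \<Rightarrow> bool" where
  "op_nonneg X A \<longleftrightarrow> (\<forall>x\<in>X. cinner (A x) x \<in> \<real>\<^sub>\<ge>\<^sub>0)"

definition orth :: "'a::fd_chilbert set \<Rightarrow> 'a set" where
  "orth X = {y. \<forall>x\<in>X. cinner y x = 0}"

definition cproj :: "'a::fd_chilbert set \<Rightarrow> 'a \<Rightarrow> 'a" where
  "cproj X x = (THE y. y \<in> X \<and> x - y \<in> orth X)"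

text \<open>\<open>0 \<in> \<rho>(A)\<close>: in finite dimensions the inverse is automatically bounded.\<close>

definition boundedly_invertible :: "'a::fd_chilbert set \<Rightarrow> 'b::fd_chilbert set \<Rightarrow> ('a \<Rightarrow> 'b) \<Rightarrow> bool" where
  "boundedly_invertible X Y A \<longleftrightarrow> bij_betw A X Y"

text \<open>Holomorphy of an operator function, through its matrix entries.\<close>

definition op_holomorphic_on ::
  "complex set \<Rightarrow> 'a::fd_chilbert set \<Rightarrow> (complex \<Rightarrow> 'a \<Rightarrow> 'b::fd_chilbert) \<Rightarrow> bool" where
  "op_holomorphic_on \<Omega> X F \<longleftrightarrow> (\<forall>x\<in>X. \<forall>y. (\<lambda>z. cinner (F z x) y) holomorphic_on \<Omega>)"

abbreviation upper_half_plane :: "complex set" where "upper_half_plane \<equiv> {z. Im z > 0}"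
abbreviation lower_half_plane :: "complex set" where "lower_half_plane \<equiv> {z. Im z < 0}"


section \<open>Symmetric systems\<close>

text \<open>
  The type \<open>('h, 'k) HH\<close> is \<open>H \<oplus> H_hat \<oplus> H\<close>, and \<open>'h \<times> 'k\<close> is \<open>H\<^sub>0 = H \<oplus> H_hat\<close>. Functions on the interval
  are total functions whose values outside the interval are irrelevant.
\<close>

type_synonym ('h, 'k) HH = "'h \<times> 'k \<times> 'h"

record ('h, 'k) sym_sys =
  lend :: real
  rend :: ereal
  ivl :: "real set"
  Bcf :: "real \<Rightarrow> ('h, 'k) HH \<Rightarrow> ('h, 'k) HH"
  Dcf :: "real \<Rightarrow> ('h, 'k) HH \<Rightarrow> ('h, 'k) HH"

definition Jop :: "('h::fd_chilbert, 'k::fd_chilbert) HH \<Rightarrow> ('h, 'k) HH" where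
  "Jop = (\<lambda>(x, y, z). (- z, \<i> *\<^sub>C y, x))"

definition borel_op :: "real set \<Rightarrow> (real \<Rightarrow> 'a::fd_chilbert \<Rightarrow> 'b::fd_chilbert) \<Rightarrow> bool" where
  "borel_op I F \<longleftrightarrow> (\<forall>h. (\<lambda>t. F t h) \<in> borel_measurable (restrict_space borel I))"

definition symmetric_system :: "('h::fd_chilbert, 'k::fd_chilbert) sym_sys \<Rightarrow> bool" where
  "symmetric_system S \<longleftrightarrow>
     ereal (lend S) < rend S
     \<and> (ivl S = {t. lend S \<le> t \<and> ereal t < rend S} \<or> ivl S = {t. lend S \<le> t \<and> ereal t \<le> rend S})
     \<and> (\<forall>t\<in>ivl S. Bcf S t \<in> operators UNIV UNIV \<and> Dcf S t \<in> operators UNIV UNIV)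
     \<and> borel_op (ivl S) (Bcf S) \<and> borel_op (ivl S) (Dcf S)
     \<and> (\<forall>\<beta>\<in>ivl S. set_integrable lborel {lend S..\<beta>} (\<lambda>t. onorm (Bcf S t))
                  \<and> set_integrable lborel {lend S..\<beta>} (\<lambda>t. onorm (Dcf S t)))
     \<and> (AE t in lborel. t \<in> ivl S \<longrightarrow>
          cadj UNIV UNIV (Bcf S t) = Bcf S t \<and> op_nonneg UNIV (Dcf S t))"

text \<open>
  A finite family of non-overlapping compact intervals is a division of its union, and
  \<open>Inf K\<close>, \<open>Sup K\<close> are the end points of its members.
\<close>

definition abs_cont_on :: "real set \<Rightarrow> (real \<Rightarrow> 'a::real_normed_vector) \<Rightarrow> bool" where
  "abs_cont_on X y \<longleftrightarrow> (\<forall>\<epsilon>>0. \<exists>\<delta>>0. \<forall>D.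
     D division_of \<Union>D \<and> \<Union>D \<subseteq> X \<and> (\<Sum>K\<in>D. Sup K - Inf K) < \<delta> \<longrightarrow>
     (\<Sum>K\<in>D. norm (y (Sup K) - y (Inf K))) < \<epsilon>)"

definition AC :: "('h::fd_chilbert, 'k::fd_chilbert) sym_sys \<Rightarrow> (real \<Rightarrow> ('h, 'k) HH) set" where
  "AC S = {y. \<forall>\<beta>\<in>ivl S. abs_cont_on {lend S..\<beta>} y}"

definition solves_system :: "('h::fd_chilbert, 'k::fd_chilbert) sym_sys
    \<Rightarrow> (real \<Rightarrow> ('h, 'k) HH) \<Rightarrow> (real \<Rightarrow> ('h, 'k) HH) \<Rightarrow> bool" where
  "solves_system S y f \<longleftrightarrow> y \<in> AC S \<and>
     (AE t in lborel. t \<in> ivl S \<longrightarrow>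
        (\<exists>y'. (y has_vector_derivative y') (at t within ivl S)
            \<and> Jop y' - Bcf S t (y t) = Dcf S t (f t)))"

definition solves_E :: "('h::fd_chilbert, 'k::fd_chilbert) sym_sys \<Rightarrow> complex
    \<Rightarrow> (real \<Rightarrow> ('h, 'k) HH) \<Rightarrow> bool" where
  "solves_E S \<mu> y \<longleftrightarrow> y \<in> AC S \<and>
     (AE t in lborel. t \<in> ivl S \<longrightarrow>
        (\<exists>y'. (y has_vector_derivative y') (at t within ivl S)
            \<and> Jop y' - Bcf S t (y t) = \<mu> *\<^sub>C Dcf S t (y t)))"

definition definite_system :: "('h::fd_chilbert, 'k::fd_chilbert) sym_sys \<Rightarrow> bool" where
  "definite_system S \<longleftrightarrow> (\<forall>\<mu> y. solves_E S \<mu> y \<and> (AE t in lborel. t \<in> ivl S \<longrightarrow> Dcf S t (y t) = 0)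
     \<longrightarrow> (\<forall>t\<in>ivl S. y t = 0))"


section \<open>The space of square integrable functions and the maximal relation\<close>

definition L2_normsq :: "('h::fd_chilbert, 'k::fd_chilbert) sym_sys \<Rightarrow> (real \<Rightarrow> ('h, 'k) HH) \<Rightarrow> ennreal" where
  "L2_normsq S f = (\<integral>\<^sup>+ t\<in>ivl S. ennreal (Re (cinner (Dcf S t (f t)) (f t))) \<partial>lborel)"

definition L2_fun :: "('h::fd_chilbert, 'k::fd_chilbert) sym_sys \<Rightarrow> (real \<Rightarrow> ('h, 'k) HH) set" where
  "L2_fun S = {f. f \<in> borel_measurable (restrict_space borel (ivl S)) \<and> L2_normsq S f < \<infinity>}"

text \<open>The quotient map \<open>\<pi>\<close>.\<close>

definition L2_class :: "('h::fd_chilbert, 'k::fd_chilbert) sym_sys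
    \<Rightarrow> (real \<Rightarrow> ('h, 'k) HH) \<Rightarrow> (real \<Rightarrow> ('h, 'k) HH) set" where
  "L2_class S f = {g \<in> L2_fun S. L2_normsq S (\<lambda>t. g t - f t) = 0}"

definition Tmax_fun :: "('h::fd_chilbert, 'k::fd_chilbert) sym_sys
    \<Rightarrow> ((real \<Rightarrow> ('h, 'k) HH) \<times> (real \<Rightarrow> ('h, 'k) HH)) set" where
  "Tmax_fun S = {(y, f). y \<in> L2_fun S \<and> f \<in> L2_fun S \<and> solves_system S y f}"

definition dom_Tmax :: "('h::fd_chilbert, 'k::fd_chilbert) sym_sys \<Rightarrow> (real \<Rightarrow> ('h, 'k) HH) set" where
  "dom_Tmax S = fst ` Tmax_fun S"

definition Tmax :: "('h::fd_chilbert, 'k::fd_chilbert) sym_sys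
    \<Rightarrow> ((real \<Rightarrow> ('h, 'k) HH) set \<times> (real \<Rightarrow> ('h, 'k) HH) set) set" where
  "Tmax S = (\<lambda>(y, f). (L2_class S y, L2_class S f)) ` Tmax_fun S"

definition ker_Tmax :: "('h::fd_chilbert, 'k::fd_chilbert) sym_sys \<Rightarrow> complex
    \<Rightarrow> (real \<Rightarrow> ('h, 'k) HH) set set" where
  "ker_Tmax S \<mu> = {L2_class S y | y. y \<in> L2_fun S \<and>
     (L2_class S y, L2_class S (\<lambda>t. \<mu> *\<^sub>C y t)) \<in> Tmax S}"

text \<open>Dimension of a subspace of the quotient space: the largest number of linearly independent classes in it.\<close>

definition L2_dim :: "('h::fd_chilbert, 'k::fd_chilbert) sym_sys
    \<Rightarrow> (real \<Rightarrow> ('h, 'k) HH) set set \<Rightarrow> enat" where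
  "L2_dim S N = Sup {enat n | n. \<exists>ys :: nat \<Rightarrow> real \<Rightarrow> ('h, 'k) HH.
     (\<forall>i<n. ys i \<in> L2_fun S \<and> L2_class S (ys i) \<in> N) \<and>
     (\<forall>c. L2_class S (\<lambda>t. \<Sum>i<n. c i *\<^sub>C ys i t) = L2_class S (\<lambda>t. 0) \<longrightarrow> (\<forall>i<n. c i = 0))}"

text \<open>
  The deficiency indices \<open>n\<^sub>\<plusminus>\<close> of the minimal relation, whose adjoint is the maximal one. As the
  dimension of the kernel is constant in each half-plane, it is taken at \<open>\<mu> = \<plusminus>\<i>\<close>.
\<close>

definition n_plus :: "('h::fd_chilbert, 'k::fd_chilbert) sym_sys \<Rightarrow> enat" where
  "n_plus S = L2_dim S (ker_Tmax S \<i>)"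

definition n_minus :: "('h::fd_chilbert, 'k::fd_chilbert) sym_sys \<Rightarrow> enat" where
  "n_minus S = L2_dim S (ker_Tmax S (- \<i>))"

definition to_rend :: "('h, 'k) sym_sys \<Rightarrow> real filter" where
  "to_rend S = (if rend S = \<infinity> then at_top else at_left (real_of_ereal (rend S)))"

definition bracket_b :: "('h::fd_chilbert, 'k::fd_chilbert) sym_sys
    \<Rightarrow> (real \<Rightarrow> ('h, 'k) HH) \<Rightarrow> (real \<Rightarrow> ('h, 'k) HH) \<Rightarrow> complex" where
  "bracket_b S y z = Lim (to_rend S) (\<lambda>t. cinner (Jop (y t)) (z t))"


section \<open>Boundary maps\<close>

text \<open>
  \<open>U\<close> has the rows \<open>(u\<^sub>1, u\<^sub>2, u\<^sub>3)\<close> and \<open>(u\<^sub>4, u\<^sub>5, u\<^sub>6)\<close>; the last two rows of its extension \<open>V\<close> are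
  those of \<open>U\<close>.
\<close>

definition boundary_operators_a ::
  "(('h::fd_chilbert, 'k::fd_chilbert) HH \<Rightarrow> 'k \<times> 'h) \<Rightarrow> (('h, 'k) HH \<Rightarrow> ('h, 'k) HH) \<Rightarrow> bool" where
  "boundary_operators_a U V \<longleftrightarrow>
     U \<in> operators UNIV UNIV \<and> surj U \<and>
     (let u1 = (\<lambda>x. fst (U (x, 0, 0))); u2 = (\<lambda>x. fst (U (0, x, 0))); u3 = (\<lambda>x. fst (U (0, 0, x)));
          u4 = (\<lambda>x. snd (U (x, 0, 0))); u5 = (\<lambda>x. snd (U (0, x, 0))); u6 = (\<lambda>x. snd (U (0, 0, x)));
          u1s = cadj UNIV UNIV u1; u2s = cadj UNIV UNIV u2; u3s = cadj UNIV UNIV u3;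
          u4s = cadj UNIV UNIV u4; u5s = cadj UNIV UNIV u5; u6s = cadj UNIV UNIV u6
      in (\<forall>x. \<i> *\<^sub>C u2 (u2s x) - u1 (u3s x) + u3 (u1s x) = \<i> *\<^sub>C x)
       \<and> (\<forall>x. \<i> *\<^sub>C u5 (u2s x) - u4 (u3s x) + u6 (u1s x) = 0)
       \<and> (\<forall>x. \<i> *\<^sub>C u5 (u5s x) + u6 (u4s x) - u4 (u6s x) = 0))
     \<and> V \<in> operators UNIV UNIV \<and> (\<forall>x. snd (V x) = U x)
     \<and> (\<forall>x. cadj UNIV UNIV V (Jop (V x)) = Jop x)"

definition Gamma0a :: "('h, 'k) sym_sys \<Rightarrow> (('h, 'k) HH \<Rightarrow> ('h, 'k) HH) \<Rightarrow> (real \<Rightarrow> ('h, 'k) HH) \<Rightarrow> 'h" where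
  "Gamma0a S V y = fst (V (y (lend S)))"

definition Gammaha :: "('h, 'k) sym_sys \<Rightarrow> (('h, 'k) HH \<Rightarrow> ('h, 'k) HH) \<Rightarrow> (real \<Rightarrow> ('h, 'k) HH) \<Rightarrow> 'k" where
  "Gammaha S V y = fst (snd (V (y (lend S))))"

definition Gamma1a :: "('h, 'k) sym_sys \<Rightarrow> (('h, 'k) HH \<Rightarrow> ('h, 'k) HH) \<Rightarrow> (real \<Rightarrow> ('h, 'k) HH) \<Rightarrow> 'h" where
  "Gamma1a S V y = snd (snd (V (y (lend S))))"

text \<open>
  The boundary map at \<open>b\<close>: the type \<open>'b\<close> is the larger space (\<open>\<H>\<^sub>b\<close> with a tilde), and \<open>Hb\<close> is its
  subspace \<open>\<H>\<^sub>b\<close>.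
\<close>

record ('h, 'k, 'b) bmap =
  Hb :: "'b set"
  Gamma0b :: "(real \<Rightarrow> ('h, 'k) HH) \<Rightarrow> 'b"
  Gammahb :: "(real \<Rightarrow> ('h, 'k) HH) \<Rightarrow> 'k"
  Gamma1b :: "(real \<Rightarrow> ('h, 'k) HH) \<Rightarrow> 'b"

definition boundary_map_b :: "('h::fd_chilbert, 'k::fd_chilbert) sym_sys
    \<Rightarrow> ('h, 'k, 'b::fd_chilbert) bmap \<Rightarrow> bool" where
  "boundary_map_b S G \<longleftrightarrow>
     csubspace (Hb G) \<and>
     (let \<Gamma> = (\<lambda>y. (Gamma0b G y, Gammahb G y, Gamma1b G y)); P = cproj (orth (Hb G)) in
       (\<forall>y\<in>dom_Tmax S. \<forall>z\<in>dom_Tmax S. \<Gamma> (\<lambda>t. y t + z t) = \<Gamma> y + \<Gamma> z)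
       \<and> (\<forall>c. \<forall>y\<in>dom_Tmax S. \<Gamma> (\<lambda>t. c *\<^sub>C y t) = c *\<^sub>C \<Gamma> y)
       \<and> \<Gamma> ` dom_Tmax S = UNIV \<times> UNIV \<times> Hb G
       \<and> (\<forall>y\<in>dom_Tmax S. \<forall>z\<in>dom_Tmax S.
            bracket_b S y z =
              cinner (Gamma0b G y) (Gamma1b G z) - cinner (Gamma1b G y) (Gamma0b G z)
              + \<i> * cinner (P (Gamma0b G y)) (P (Gamma0b G z))
              + \<i> * cinner (Gammahb G y) (Gammahb G z)))"


section \<open>Boundary parameters\<close>

record 'b bparam =
  C0 :: "complex \<Rightarrow> 'b \<Rightarrow> 'b"
  C1 :: "complex \<Rightarrow> 'b \<Rightarrow> 'b"
  D0 :: "complex \<Rightarrow> 'b \<Rightarrow> 'b"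
  D1 :: "complex \<Rightarrow> 'b \<Rightarrow> 'b"

text \<open>
  Representatives of the collections \<open>{\<tau>\<^sub>+, \<tau>\<^sub>-}\<close>. The blocks of \<open>C\<^sub>0 = (C\<^sub>0\<^sub>1, C\<^sub>0\<^sub>2)\<close> are the
  restrictions of \<open>C\<^sub>0\<close> to \<open>K\<close> and to \<open>orth K\<close>, likewise for \<open>D\<^sub>0\<close>; so \<open>cadj K UNIV (C0 \<tau> \<mu>)\<close> is the
  adjoint of \<open>C\<^sub>0\<^sub>1(\<mu>)\<close>.
\<close>

definition boundary_param :: "'b::fd_chilbert set \<Rightarrow> 'b bparam \<Rightarrow> bool" where
  "boundary_param K \<tau> \<longleftrightarrow>
     (\<forall>\<mu>\<in>upper_half_plane. C0 \<tau> \<mu> \<in> operators UNIV UNIV \<and> C1 \<tau> \<mu> \<in> operators K UNIV)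
     \<and> (\<forall>\<mu>\<in>lower_half_plane. D0 \<tau> \<mu> \<in> operators UNIV K \<and> D1 \<tau> \<mu> \<in> operators K K)
     \<and> op_holomorphic_on upper_half_plane UNIV (C0 \<tau>)
     \<and> op_holomorphic_on upper_half_plane K (C1 \<tau>)
     \<and> op_holomorphic_on lower_half_plane UNIV (D0 \<tau>)
     \<and> op_holomorphic_on lower_half_plane K (D1 \<tau>)
     \<and> (\<forall>\<mu>\<in>upper_half_plane. op_nonneg UNIV (\<lambda>x.
          2 *\<^sub>C op_Im UNIV (\<lambda>x. C1 \<tau> \<mu> (cadj K UNIV (C0 \<tau> \<mu>) x)) x
          + C0 \<tau> \<mu> (cadj (orth K) UNIV (C0 \<tau> \<mu>) x)))
     \<and> (\<forall>\<mu>\<in>lower_half_plane. op_nonneg K (\<lambda>x. -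
          (2 *\<^sub>C op_Im K (\<lambda>x. D1 \<tau> \<mu> (cadj K K (D0 \<tau> \<mu>) x)) x
           + D0 \<tau> \<mu> (cadj (orth K) K (D0 \<tau> \<mu>) x))))
     \<and> (\<forall>\<mu>\<in>upper_half_plane. \<forall>x\<in>K.
          C1 \<tau> \<mu> (cadj K K (D0 \<tau> (cnj \<mu>)) x) - C0 \<tau> \<mu> (cadj K K (D1 \<tau> (cnj \<mu>)) x)
          + \<i> *\<^sub>C C0 \<tau> \<mu> (cadj (orth K) K (D0 \<tau> (cnj \<mu>)) x) = 0)
     \<and> (\<forall>\<mu>\<in>upper_half_plane.
          boundedly_invertible UNIV UNIV (\<lambda>x. C0 \<tau> \<mu> x - \<i> *\<^sub>C C1 \<tau> \<mu> (cproj K x)))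
     \<and> (\<forall>\<mu>\<in>lower_half_plane.
          boundedly_invertible K K (\<lambda>x. D0 \<tau> \<mu> x + \<i> *\<^sub>C D1 \<tau> \<mu> x))"

definition tau0 :: "'b::fd_chilbert set \<Rightarrow> 'b bparam" where
  "tau0 K = \<lparr>C0 = (\<lambda>\<mu> x. x), C1 = (\<lambda>\<mu> x. 0), D0 = (\<lambda>\<mu>. cproj K), D1 = (\<lambda>\<mu> x. 0)\<rparr>"


section \<open>Operator solutions and the m-function\<close>

definition L2_op_solution :: "('h::fd_chilbert, 'k::fd_chilbert) sym_sys \<Rightarrow> complex
    \<Rightarrow> (real \<Rightarrow> 'c::fd_chilbert \<Rightarrow> ('h, 'k) HH) \<Rightarrow> bool" where
  "L2_op_solution S \<mu> Y \<longleftrightarrow>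
     (\<forall>t\<in>ivl S. Y t \<in> operators UNIV UNIV)
     \<and> (\<forall>h. (\<lambda>t. Y t h) \<in> L2_fun S \<and> solves_E S \<mu> (\<lambda>t. Y t h))"

text \<open>The boundary conditions at \<open>a\<close> (and the coupled one) with right-hand sides \<open>- P\<^sub>H\<close> and \<open>P\<close> onto \<open>H_hat\<close>.\<close>

definition normalized_at_a :: "('h::fd_chilbert, 'k::fd_chilbert) sym_sys
    \<Rightarrow> (('h, 'k) HH \<Rightarrow> ('h, 'k) HH) \<Rightarrow> ('h, 'k, 'b::fd_chilbert) bmap
    \<Rightarrow> (real \<Rightarrow> 'h \<times> 'k \<Rightarrow> ('h, 'k) HH) \<Rightarrow> bool" where
  "normalized_at_a S V G Y \<longleftrightarrow>
     (\<forall>h. Gamma1a S V (\<lambda>t. Y t h) = - fst h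
        \<and> \<i> *\<^sub>C (Gammaha S V (\<lambda>t. Y t h) - Gammahb G (\<lambda>t. Y t h)) = snd h)"

definition is_v0 :: "('h::fd_chilbert, 'k::fd_chilbert) sym_sys
    \<Rightarrow> (('h, 'k) HH \<Rightarrow> ('h, 'k) HH) \<Rightarrow> ('h, 'k, 'b::fd_chilbert) bmap \<Rightarrow> complex
    \<Rightarrow> (real \<Rightarrow> 'h \<times> 'k \<Rightarrow> ('h, 'k) HH) \<Rightarrow> bool" where
  "is_v0 S V G \<mu> Y \<longleftrightarrow> L2_op_solution S \<mu> Y \<and> normalized_at_a S V G Y
     \<and> (Im \<mu> > 0 \<longrightarrow> (\<forall>h. Gamma0b G (\<lambda>t. Y t h) = 0))
     \<and> (Im \<mu> < 0 \<longrightarrow> (\<forall>h. cproj (Hb G) (Gamma0b G (\<lambda>t. Y t h)) = 0))"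

definition is_u_plus :: "('h::fd_chilbert, 'k::fd_chilbert) sym_sys
    \<Rightarrow> (('h, 'k) HH \<Rightarrow> ('h, 'k) HH) \<Rightarrow> ('h, 'k, 'b::fd_chilbert) bmap \<Rightarrow> complex
    \<Rightarrow> (real \<Rightarrow> 'b \<Rightarrow> ('h, 'k) HH) \<Rightarrow> bool" where
  "is_u_plus S V G \<mu> Y \<longleftrightarrow> L2_op_solution S \<mu> Y \<and>
     (\<forall>h. Gamma1a S V (\<lambda>t. Y t h) = 0
        \<and> \<i> *\<^sub>C (Gammaha S V (\<lambda>t. Y t h) - Gammahb G (\<lambda>t. Y t h)) = 0
        \<and> Gamma0b G (\<lambda>t. Y t h) = h)"

definition is_v_tau :: "('h::fd_chilbert, 'k::fd_chilbert) sym_sys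
    \<Rightarrow> (('h, 'k) HH \<Rightarrow> ('h, 'k) HH) \<Rightarrow> ('h, 'k, 'b::fd_chilbert) bmap \<Rightarrow> 'b bparam \<Rightarrow> complex
    \<Rightarrow> (real \<Rightarrow> 'h \<times> 'k \<Rightarrow> ('h, 'k) HH) \<Rightarrow> bool" where
  "is_v_tau S V G \<tau> \<mu> Y \<longleftrightarrow> L2_op_solution S \<mu> Y \<and> normalized_at_a S V G Y
     \<and> (Im \<mu> > 0 \<longrightarrow>
          (\<forall>h. C0 \<tau> \<mu> (Gamma0b G (\<lambda>t. Y t h)) + C1 \<tau> \<mu> (Gamma1b G (\<lambda>t. Y t h)) = 0))
     \<and> (Im \<mu> < 0 \<longrightarrow>
          (\<forall>h. D0 \<tau> \<mu> (Gamma0b G (\<lambda>t. Y t h)) + D1 \<tau> \<mu> (Gamma1b G (\<lambda>t. Y t h)) = 0))"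

text \<open>\<open>(\<Gamma>\<^sub>0\<^sub>a + Gamma_hat_a) Y\<close>, with values in \<open>H \<oplus> H_hat\<close>, and the same with half the imaginary unit times the
  projection onto \<open>H_hat\<close> added.\<close>

definition Gamma0ha :: "('h, 'k) sym_sys \<Rightarrow> (('h, 'k) HH \<Rightarrow> ('h, 'k) HH)
    \<Rightarrow> (real \<Rightarrow> 'c \<Rightarrow> ('h, 'k) HH) \<Rightarrow> 'c \<Rightarrow> 'h \<times> 'k" where
  "Gamma0ha S V Y = (\<lambda>h. (Gamma0a S V (\<lambda>t. Y t h), Gammaha S V (\<lambda>t. Y t h)))"

definition m_of_solution :: "('h::fd_chilbert, 'k::fd_chilbert) sym_sys
    \<Rightarrow> (('h, 'k) HH \<Rightarrow> ('h, 'k) HH) \<Rightarrow> (real \<Rightarrow> 'h \<times> 'k \<Rightarrow> ('h, 'k) HH)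
    \<Rightarrow> 'h \<times> 'k \<Rightarrow> 'h \<times> 'k" where
  "m_of_solution S V Y = (\<lambda>h. Gamma0ha S V Y h + (\<i> / 2) *\<^sub>C (0, snd h))"

text \<open>
  The solution is unique only up to its values outside the interval, so the description operator
  is applied to the value of the m-function and not to the solution itself.
\<close>

definition m_fun :: "('h::fd_chilbert, 'k::fd_chilbert) sym_sys
    \<Rightarrow> (('h, 'k) HH \<Rightarrow> ('h, 'k) HH) \<Rightarrow> ('h, 'k, 'b::fd_chilbert) bmap \<Rightarrow> 'b bparam
    \<Rightarrow> complex \<Rightarrow> 'h \<times> 'k \<Rightarrow> 'h \<times> 'k" where
  "m_fun S V G \<tau> \<mu> = (THE M. \<exists>Y. is_v_tau S V G \<tau> \<mu> Y \<and> M = m_of_solution S V Y)"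

end

theory Submission
  imports Defs
begin

text \<open>
  The formula is forced by linearity once the homogeneous boundary problem is known to have only the
  trivial solution. For \<open>Im \<mu> > 0\<close> the functions \<open>v0 h + u_plus x\<close> satisfy the normalization of
  \<open>v_tau h\<close> for all \<open>x\<close>, and their boundary values at \<open>b\<close> are \<open>\<Gamma>\<^sub>0\<^sub>b = x\<close> and \<open>\<Gamma>\<^sub>1\<^sub>b = - M3 h - M4 x\<close>. Hence the
  condition \<open>C0 \<Gamma>\<^sub>0\<^sub>b + C1 \<Gamma>\<^sub>1\<^sub>b = 0\<close> reads \<open>(C0 - C1 M4) x = C1 M3 h\<close>. An element \<open>x\<close> of the kernel of
  \<open>C0 - C1 M4\<close> gives the homogeneous solution \<open>u_plus x\<close>, so uniqueness makes this operator injective, thus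
  invertible in finite dimensions; applying the boundary maps at \<open>a\<close> to \<open>v0 h + u_plus x\<close> yields the
  formula. Uniqueness also shows that the description operator defining \<open>m_fun\<close> denotes the value
  of any solution, which gives \<open>m0\<close> for the parameter \<open>tau0\<close>, whose boundary conditions are those of \<open>v0\<close>.

  Uniqueness (\<open>homogeneous_problem\<close>) rests on the Lagrange identity. Along a square integrable solution \<open>y\<close>
  the real function \<open>(J y, y) / i\<close> has the derivative \<open>2 Im \<mu> (\<Delta> y, y)\<close> almost everywhere, so its
  increments have the sign of \<open>Im \<mu>\<close>. The boundary conditions give the opposite sign to the total increment
  between \<open>a\<close> and \<open>b\<close>: the contributions of \<open>\<Gamma>_hat\<close> at the two ends cancel, and what remains at
  \<open>b\<close> is \<open>2 Im (\<Gamma>\<^sub>0\<^sub>b y, \<Gamma>\<^sub>1\<^sub>b y) + |P \<Gamma>\<^sub>0\<^sub>b y|\<^sup>2\<close> with \<open>P\<close> the projection onto the complement of \<open>\<H>\<^sub>b\<close>. By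
  \<open>boundary_param_dissipative\<close> it is at most zero for every boundary parameter if \<open>Im \<mu> > 0\<close>, while for
  \<open>Im \<mu> < 0\<close> and the parameter \<open>tau0\<close> its first summand vanishes and it is at least zero. So the
  function is constant, \<open>\<Delta> y = 0\<close> almost everywhere, and \<open>y = 0\<close> by definiteness (\<open>solution_vanishes\<close>).

  The monotonicity needs the fundamental theorem of calculus for absolutely continuous functions
  (\<open>abs_cont_fundamental_theorem\<close>), and the linear algebra needs adjoints and projections in the class of
  spaces at hand.
\<close>

section \<open>The inner product\<close>

lemma scaleC_0_left [simp]: "0 *\<^sub>C (x::'a::fd_chilbert) = 0"
  using scaleR_scaleC[of 0 x] by simp

lemma scaleC_0_right [simp]: "c *\<^sub>C (0::'a::fd_chilbert) = 0"
  using scaleC_add_right[of c "0::'a" 0] by simp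

lemma scaleC_1 [simp]: "1 *\<^sub>C (x::'a::fd_chilbert) = x"
  using scaleR_scaleC[of 1 x] by simp

lemma scaleC_minus_right: "c *\<^sub>C (- x) = - (c *\<^sub>C (x::'a::fd_chilbert))"
  using scaleC_add_right[of c x "- x"] by (simp add: eq_neg_iff_add_eq_0 add.commute)

lemma scaleC_minus_left: "(- c) *\<^sub>C (x::'a::fd_chilbert) = - (c *\<^sub>C x)"
  using scaleC_add_left[of c "- c" x] by (simp add: eq_neg_iff_add_eq_0 add.commute)

lemma scaleC_diff_right: "c *\<^sub>C (x - y) = c *\<^sub>C x - c *\<^sub>C (y::'a::fd_chilbert)"
  using scaleC_add_right[of c x "- y"] by (simp add: scaleC_minus_right)

lemma scaleC_diff_left: "(c - d) *\<^sub>C x = c *\<^sub>C x - d *\<^sub>C (x::'a::fd_chilbert)"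
  using scaleC_add_left[of c "- d" x] by (simp add: scaleC_minus_left)

lemma scaleC_neg1: "(- 1) *\<^sub>C (x::'a::fd_chilbert) = - x"
  by (simp add: scaleC_minus_left)

lemma cinner_add_right: "cinner x (y + z) = cinner x y + cinner x (z::'a::fd_chilbert)"
  by (metis cinner_add_left cinner_commute complex_cnj_add)

lemma cinner_scaleC_right: "cinner x (c *\<^sub>C y) = cnj c * cinner x (y::'a::fd_chilbert)"
  by (metis cinner_commute cinner_scaleC_left complex_cnj_mult)

lemma cinner_0_left [simp]: "cinner 0 (x::'a::fd_chilbert) = 0"
  using cinner_scaleC_left[of 0 x x] by simp

lemma cinner_0_right [simp]: "cinner (x::'a::fd_chilbert) 0 = 0"
  using cinner_scaleC_right[of x 0 x] by simp

lemma cinner_minus_left: "cinner (- x) (y::'a::fd_chilbert) = - cinner x y"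
  using cinner_scaleC_left[of "- 1" x y] by (simp add: scaleC_neg1)

lemma cinner_minus_right: "cinner x (- (y::'a::fd_chilbert)) = - cinner x y"
  using cinner_scaleC_right[of x "- 1" y] by (simp add: scaleC_neg1)

lemma cinner_diff_left: "cinner (x - y) (z::'a::fd_chilbert) = cinner x z - cinner y z"
  using cinner_add_left[of x "- y" z] by (simp add: cinner_minus_left)

lemma cinner_diff_right: "cinner x (y - (z::'a::fd_chilbert)) = cinner x y - cinner x z"
  using cinner_add_right[of x y "- z"] by (simp add: cinner_minus_right)

lemma cinner_sum_left: "cinner (\<Sum>i\<in>I. f i) (x::'a::fd_chilbert) = (\<Sum>i\<in>I. cinner (f i) x)"
  by (induction I rule: infinite_finite_induct) (auto simp: cinner_add_left)

lemmas cinner_simps = cinner_add_left cinner_add_right cinner_diff_left cinner_diff_right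
  cinner_minus_left cinner_minus_right cinner_scaleC_left cinner_scaleC_right

lemma cinner_self: "cinner x (x::'a::fd_chilbert) = complex_of_real ((norm x)\<^sup>2)"
proof -
  have "Im (cinner x x) = 0"
    using arg_cong[OF cinner_commute[of x x], of Im] by simp
  then show ?thesis
    by (simp add: complex_eq_iff power2_norm_eq_inner inner_eq_Re_cinner)
qed

lemma cinner_self_eq_0 [simp]: "cinner x x = 0 \<longleftrightarrow> (x::'a::fd_chilbert) = 0"
  by (simp add: cinner_self)

lemma norm_scaleC: "norm (c *\<^sub>C x) = norm c * norm (x::'a::fd_chilbert)"
proof -
  have "complex_of_real ((norm (c *\<^sub>C x))\<^sup>2) = complex_of_real ((norm c * norm x)\<^sup>2)"
    unfolding cinner_self[symmetric] cinner_scaleC_left cinner_scaleC_right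
    by (simp add: cinner_self power_mult_distrib complex_norm_square[of c, symmetric] mult_ac
          flip: of_real_power)
  then have "(norm (c *\<^sub>C x))\<^sup>2 = (norm c * norm x)\<^sup>2"
    by (simp only: of_real_eq_iff)
  then show ?thesis by simp
qed

text \<open>Cauchy--Schwarz follows from its real form after the phase of \<open>cinner x y\<close> is absorbed in \<open>x\<close>.\<close>

lemma norm_cinner_le: "norm (cinner x y) \<le> norm x * norm (y::'a::fd_chilbert)"
proof (cases "cinner x y = 0")
  case False
  define w where "w = cnj (cinner x y) / norm (cinner x y)"
  have w: "norm w = 1" using False by (simp add: w_def norm_divide)
  have "w * cinner x y = norm (cinner x y)"
    using False by (simp add: w_def field_simps)
       (metis complex_norm_square mult.commute of_real_mult power2_eq_square)
  then have "norm (cinner x y) = inner (w *\<^sub>C x) y"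
    by (simp add: inner_eq_Re_cinner cinner_scaleC_left)
  also have "\<dots> \<le> norm (w *\<^sub>C x) * norm y" by (rule norm_cauchy_schwarz)
  finally show ?thesis by (simp add: norm_scaleC w)
qed simp

lemma bounded_bilinear_scaleC: "bounded_bilinear (\<lambda>c (x::'a::fd_chilbert). c *\<^sub>C x)"
  by unfold_locales
     (auto simp: scaleC_add_left scaleC_add_right scaleR_scaleC scaleC_scaleC scaleR_conv_of_real mult.commute norm_scaleC intro!: exI[of _ 1])

lemma bounded_bilinear_cinner: "bounded_bilinear (cinner :: 'a::fd_chilbert \<Rightarrow> 'a \<Rightarrow> complex)"
  by unfold_locales
     (auto simp: cinner_add_left cinner_add_right scaleR_scaleC cinner_scaleC_left cinner_scaleC_right
        scaleR_conv_of_real intro!: exI[of _ 1] norm_cinner_le)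

lemmas continuous_on_cinner [continuous_intros] =
    bounded_bilinear.continuous_on[OF bounded_bilinear_cinner]
  and continuous_on_scaleC [continuous_intros] =
    bounded_bilinear.continuous_on[OF bounded_bilinear_scaleC]

section \<open>Measurability\<close>

text \<open>
  Coefficients from a countable dense set of scalars approximate every combination. This makes the
  spaces separable, hence second countable.
\<close>

lemma countable_dense_combinations:
  assumes "finite (B::'a::fd_chilbert set)"
  shows "\<exists>D. countable D \<and> (\<forall>c. \<forall>\<epsilon>>0. \<exists>d\<in>D. dist d (\<Sum>b\<in>B. c b *\<^sub>C b) < \<epsilon>)"
  using assms
proof induction
  case empty
  show ?case by (intro exI[of _ "{0}"]) auto
next
  case (insert x B)
  then obtain D where D: "countable D" "\<And>c \<epsilon>. \<epsilon> > 0 \<Longrightarrow> \<exists>d\<in>D. dist d (\<Sum>b\<in>B. c b *\<^sub>C b) < \<epsilon>"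
    by metis
  obtain Q :: "complex set" where Q: "countable Q" "\<And>X. open X \<Longrightarrow> X \<noteq> {} \<Longrightarrow> \<exists>q\<in>Q. q \<in> X"
    using countable_dense_exists by metis
  let ?D = "(\<lambda>(d, q). d + q *\<^sub>C x) ` (D \<times> Q)"
  have "\<exists>d\<in>?D. dist d (\<Sum>b\<in>insert x B. c b *\<^sub>C b) < \<epsilon>" if pos: "\<epsilon> > 0" for c and \<epsilon> :: real
  proof -
    obtain d where d: "d \<in> D" "dist d (\<Sum>b\<in>B. c b *\<^sub>C b) < \<epsilon> / 2"
      using D(2)[OF half_gt_zero[OF pos]] by blast
    have "\<exists>q\<in>Q. q \<in> ball (c x) (\<epsilon> / (2 * (norm x + 1)))"
      using pos by (intro Q(2)) (auto simp: ball_eq_empty not_le intro!: divide_pos_pos add_nonneg_pos)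
    then obtain q where q: "q \<in> Q" "norm (q - c x) < \<epsilon> / (2 * (norm x + 1))"
      by (auto simp: dist_norm norm_minus_commute)
    have "norm ((q - c x) *\<^sub>C x) \<le> norm (q - c x) * (norm x + 1)"
      by (simp add: norm_scaleC mult_left_mono)
    also have "\<dots> < \<epsilon> / 2"
      using q(2) by (simp add: field_simps add_pos_nonneg pos_less_divide_eq)
    finally have n: "norm ((q - c x) *\<^sub>C x) < \<epsilon> / 2" .
    have "dist (d + q *\<^sub>C x) (\<Sum>b\<in>insert x B. c b *\<^sub>C b)
        = norm ((d - (\<Sum>b\<in>B. c b *\<^sub>C b)) + (q - c x) *\<^sub>C x)"
      using insert.hyps by (simp add: dist_norm scaleC_diff_left algebra_simps)
    also have "\<dots> \<le> norm (d - (\<Sum>b\<in>B. c b *\<^sub>C b)) + norm ((q - c x) *\<^sub>C x)"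
      by (rule norm_triangle_ineq)
    also have "\<dots> < \<epsilon>" using d(2) n by (simp add: dist_norm)
    finally show ?thesis using d(1) q(1) by force
  qed
  moreover have "countable ?D" using D(1) Q(1) by blast
  ultimately show ?case by blast
qed

text \<open>
  Second countability is what makes sums and products of vector-valued Borel functions Borel again.
\<close>

instance fd_chilbert \<subseteq> second_countable_topology
proof
  obtain B :: "'a set" where B: "finite B" "\<And>x. \<exists>c. x = (\<Sum>b\<in>B. c b *\<^sub>C b)"
    using finite_dimensional by blast
  obtain D where D: "countable D" "\<And>c \<epsilon>. \<epsilon> > 0 \<Longrightarrow> \<exists>d\<in>D. dist d (\<Sum>b\<in>B. c b *\<^sub>C b) < \<epsilon>"
    using countable_dense_combinations[OF B(1)] by metis
  define \<B> where "\<B> = (\<lambda>(d, n). ball d (1 / real (Suc n))) ` (D \<times> (UNIV::nat set))"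
  have "topological_basis \<B>"
  proof (rule topological_basisI)
    show "open U" if "U \<in> \<B>" for U using that by (auto simp: \<B>_def)
    fix W and x :: 'a assume "open W" "x \<in> W"
    then obtain e where e: "e > 0" "ball x e \<subseteq> W" by (auto simp: open_contains_ball)
    obtain n where n: "1 / real (Suc n) < e / 2"
      using e(1) nat_approx_posE[of "e / 2"] half_gt_zero by blast
    obtain d where d: "d \<in> D" "dist d x < 1 / real (Suc n)"
      using B(2)[of x] D(2)[of "1 / real (Suc n)"] by fastforce
    have "ball d (1 / real (Suc n)) \<subseteq> ball x e"
    proof
      fix z assume "z \<in> ball d (1 / real (Suc n))"
      then have "dist x z < e"
        using d(2) n dist_triangle[of x z d] unfolding mem_ball dist_commute[of x d] by linarith
      then show "z \<in> ball x e" by simp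
    qed
    then show "\<exists>U\<in>\<B>. x \<in> U \<and> U \<subseteq> W"
      using d e(2) by (intro bexI[of _ "ball d (1 / real (Suc n))"]) (auto simp: \<B>_def)
  qed
  moreover have "countable \<B>" unfolding \<B>_def using D(1) by blast
  ultimately show "\<exists>\<B>::'a set set. countable \<B> \<and> open = generate_topology \<B>"
    using topological_basis_imp_subbasis by blast
qed

lemma borel_measurable_cinner [measurable (raw)]:
  fixes f g :: "'m \<Rightarrow> 'a::fd_chilbert"
  assumes "f \<in> borel_measurable M" "g \<in> borel_measurable M"
  shows "(\<lambda>t. cinner (f t) (g t)) \<in> borel_measurable M"
  by (rule borel_measurable_continuous_Pair[OF assms]) (intro continuous_intros)

lemma borel_measurable_scaleC [measurable (raw)]:
  fixes f :: "'m \<Rightarrow> complex" and g :: "'m \<Rightarrow> 'a::fd_chilbert"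
  assumes "f \<in> borel_measurable M" "g \<in> borel_measurable M"
  shows "(\<lambda>t. f t *\<^sub>C g t) \<in> borel_measurable M"
  by (rule borel_measurable_continuous_Pair[OF assms]) (intro continuous_intros)

section \<open>Orthogonal projections, representation of functionals, adjoints\<close>

lemma operatorsD:
  assumes "A \<in> operators X Y"
  shows operators_mem: "x \<in> X \<Longrightarrow> A x \<in> Y"
    and operators_add: "x \<in> X \<Longrightarrow> y \<in> X \<Longrightarrow> A (x + y) = A x + A y"
    and operators_scaleC: "x \<in> X \<Longrightarrow> A (c *\<^sub>C x) = c *\<^sub>C A x"
  using assms by (auto simp: operators_def)

lemma operators_mono: "A \<in> operators X Y \<Longrightarrow> X' \<subseteq> X \<Longrightarrow> Y \<subseteq> Y' \<Longrightarrow> A \<in> operators X' Y'"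
  by (auto simp: operators_def subset_eq)

lemma operators_0:
  assumes "A \<in> operators X Y" "csubspace X"
  shows "A 0 = 0"
  using operators_scaleC[OF assms(1), of 0 0] assms(2) by (simp add: csubspace_def)

lemma csubspaceD:
  assumes "csubspace X"
  shows csubspace_0: "0 \<in> X"
    and csubspace_add: "x \<in> X \<Longrightarrow> y \<in> X \<Longrightarrow> x + y \<in> X"
    and csubspace_scaleC: "x \<in> X \<Longrightarrow> c *\<^sub>C x \<in> X"
    and csubspace_minus: "x \<in> X \<Longrightarrow> - x \<in> X"
    and csubspace_diff: "x \<in> X \<Longrightarrow> y \<in> X \<Longrightarrow> x - y \<in> X"
proof -
  note * = assms[unfolded csubspace_def]
  show "0 \<in> X" "x \<in> X \<Longrightarrow> y \<in> X \<Longrightarrow> x + y \<in> X" "x \<in> X \<Longrightarrow> c *\<^sub>C x \<in> X" for x y c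
    using * by auto
  show neg: "x \<in> X \<Longrightarrow> - x \<in> X" for x using * scaleC_neg1[of x] by metis
  show "x \<in> X \<Longrightarrow> y \<in> X \<Longrightarrow> x - y \<in> X" for x y
    using * neg[of y] by (metis diff_conv_add_uminus)
qed

lemma csubspace_UNIV: "csubspace UNIV"
  by (simp add: csubspace_def)

lemma csubspace_orth: "csubspace (orth X)"
  by (auto simp: csubspace_def orth_def cinner_simps)

lemma operators_diff:
  assumes "A \<in> operators X Y" "csubspace X" "x \<in> X" "y \<in> X"
  shows "A (x - y) = A x - A y"
  using operators_add[OF assms(1), of "x - y" y] csubspace_diff[OF assms(2-4)] assms(4) by simp

lemma subspace_if_csubspace: "csubspace X \<Longrightarrow> subspace X"
  by (auto simp: csubspace_def subspace_def scaleR_scaleC)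

lemma finite_real_spanning_set: "\<exists>B::'a::fd_chilbert set. finite B \<and> span B = UNIV"
proof -
  obtain B :: "'a set" where B: "finite B" "\<And>x. \<exists>c. x = (\<Sum>b\<in>B. c b *\<^sub>C b)"
    using finite_dimensional by blast
  let ?B = "B \<union> (\<lambda>b. \<i> *\<^sub>C b) ` B"
  have "x \<in> span ?B" for x
  proof -
    obtain c where "x = (\<Sum>b\<in>B. c b *\<^sub>C b)" using B(2) by blast
    moreover have "c b *\<^sub>C b = Re (c b) *\<^sub>R b + Im (c b) *\<^sub>R (\<i> *\<^sub>C b)" for b
      by (simp add: scaleR_scaleC scaleC_scaleC scaleC_add_left[symmetric] mult.commute[of _ \<i>]
          complex_eq[symmetric])
    ultimately show ?thesis
      by (auto intro!: span_sum span_add span_scale intro: span_base)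
  qed
  then show ?thesis using B(1) by (intro exI[of _ ?B]) auto
qed

lemma finite_real_basis:
  fixes X :: "'a::fd_chilbert set"
  assumes "csubspace X"
  obtains B where "finite B" "independent B" "span B = X"
proof -
  obtain F :: "'a set" where F: "finite F" "span F = UNIV" using finite_real_spanning_set by blast
  obtain B where B: "B \<subseteq> X" "independent B" "X \<subseteq> span B"
    by (rule maximal_independent_subset)
  have "finite B" using independent_span_bound[OF F(1) B(2)] F(2) by simp
  moreover have "span B = X"
    using B(1,3) span_minimal[OF B(1) subspace_if_csubspace[OF assms]] by blast
  ultimately show ?thesis using B(2) that by blast
qed

text \<open>
  Gram--Schmidt over the complex numbers: the normalized residue of a new vector is added to the
  family unless it vanishes. The vectors that the family expands form a real subspace, so it suffices
  to treat a finite set whose real span is the space.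
\<close>

lemma finite_orthonormal_expansion:
  assumes "finite B" "B \<subseteq> X" "csubspace (X::'a::fd_chilbert set)"
  shows "\<exists>E. finite E \<and> E \<subseteq> X \<and> (\<forall>e\<in>E. \<forall>f\<in>E. cinner e f = (if e = f then 1 else 0))
     \<and> (\<forall>x\<in>B. x = (\<Sum>e\<in>E. cinner x e *\<^sub>C e))"
  using assms
proof induction
  case empty
  show ?case by (intro exI[of _ "{}"]) auto
next
  case (insert b B)
  then obtain E where E: "finite E" "E \<subseteq> X"
    "\<And>e f. e \<in> E \<Longrightarrow> f \<in> E \<Longrightarrow> cinner e f = (if e = f then 1 else 0)"
    "\<And>x. x \<in> B \<Longrightarrow> x = (\<Sum>e\<in>E. cinner x e *\<^sub>C e)"
    by (metis insert_subset)
  define r where "r = b - (\<Sum>e\<in>E. cinner b e *\<^sub>C e)"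
  have sumX: "(\<Sum>e\<in>E. c e *\<^sub>C e) \<in> X" for c
    using E(1,2) csubspace_0[OF insert.prems(2)] csubspace_add[OF insert.prems(2)]
      csubspace_scaleC[OF insert.prems(2)]
    by (induction E) auto
  show ?case
  proof (cases "r = 0")
    case True
    then have "b = (\<Sum>e\<in>E. cinner b e *\<^sub>C e)"
      unfolding r_def right_minus_eq .
    then have "\<forall>x\<in>insert b B. x = (\<Sum>e\<in>E. cinner x e *\<^sub>C e)"
      using E(4) by blast
    moreover have "\<forall>e\<in>E. \<forall>f\<in>E. cinner e f = (if e = f then 1 else 0)"
      using E(3) by simp
    ultimately show ?thesis using E(1,2) by (intro exI[of _ E] conjI)
  next
    case False
    have rE: "cinner r f = 0" if "f \<in> E" for f
    proof -
      have "cinner (\<Sum>e\<in>E. cinner b e *\<^sub>C e) f = (\<Sum>e\<in>E. if e = f then cinner b e else 0)"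
        unfolding cinner_sum_left using E(3) that by (intro sum.cong) (auto simp: cinner_simps)
      then show ?thesis using E(1) that by (simp add: r_def cinner_simps)
    qed
    define e0 where "e0 = complex_of_real (1 / norm r) *\<^sub>C r"
    have e0: "cinner e0 e0 = 1"
      unfolding e0_def cinner_scaleC_left cinner_scaleC_right
      using False by (simp add: cinner_self power2_eq_square)
    have e0E: "cinner e0 f = 0" "cinner f e0 = 0" if "f \<in> E" for f
      using rE[OF that] cinner_commute[of f r] by (auto simp: e0_def cinner_simps)
    have new: "e0 \<notin> E" using e0 e0E by force
    have "b = (\<Sum>e\<in>insert e0 E. cinner b e *\<^sub>C e)"
    proof -
      have "cinner b e0 = cinner r e0"
      proof -
        have "cinner (\<Sum>e\<in>E. cinner b e *\<^sub>C e) e0 = 0"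
          unfolding cinner_sum_left using e0E by (intro sum.neutral) (auto simp: cinner_simps)
        then show ?thesis by (simp add: r_def cinner_simps)
      qed
      then have "cinner b e0 *\<^sub>C e0 = r"
        unfolding e0_def cinner_scaleC_right
        using False by (simp add: cinner_self scaleC_scaleC power2_eq_square)
      then show ?thesis using E(1) new by (simp add: r_def)
    qed
    moreover have "\<forall>x\<in>B. x = (\<Sum>e\<in>insert e0 E. cinner x e *\<^sub>C e)"
    proof
      fix x assume x: "x \<in> B"
      have "cinner x e0 = cinner (\<Sum>e\<in>E. cinner x e *\<^sub>C e) e0"
        by (rule arg_cong[OF E(4)[OF x]])
      also have "\<dots> = 0"
        unfolding cinner_sum_left using e0E by (intro sum.neutral) (auto simp: cinner_simps)
      finally have "(\<Sum>e\<in>insert e0 E. cinner x e *\<^sub>C e) = (\<Sum>e\<in>E. cinner x e *\<^sub>C e)"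
        using E(1) new by simp
      then show "x = (\<Sum>e\<in>insert e0 E. cinner x e *\<^sub>C e)"
        by (rule trans[OF E(4)[OF x] sym])
    qed
    moreover have "e0 \<in> X"
      using insert.prems sumX unfolding e0_def r_def
      by (intro csubspace_scaleC csubspace_diff) auto
    moreover have "finite (insert e0 E)" "insert e0 E \<subseteq> X \<longleftrightarrow> e0 \<in> X"
      "\<forall>e\<in>insert e0 E. \<forall>f\<in>insert e0 E. cinner e f = (if e = f then 1 else 0)"
      using E(1-3) e0 e0E new by auto
    ultimately show ?thesis
      by (intro exI[of _ "insert e0 E"] conjI) (assumption | simp only: ball_simps)+
  qed
qed

lemma orthonormal_basis_exists:
  assumes "csubspace (X::'a::fd_chilbert set)"
  shows "\<exists>E. finite E \<and> E \<subseteq> X \<and> (\<forall>e\<in>E. \<forall>f\<in>E. cinner e f = (if e = f then 1 else 0))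
     \<and> (\<forall>x\<in>X. (\<Sum>e\<in>E. cinner x e *\<^sub>C e) = x)"
proof -
  obtain B where B: "finite B" "span B = X"
    using finite_real_basis[OF assms] by blast
  then have "B \<subseteq> X" using span_superset by blast
  from finite_orthonormal_expansion[OF B(1) this assms] obtain E where E: "finite E" "E \<subseteq> X"
    "\<forall>e\<in>E. \<forall>f\<in>E. cinner e f = (if e = f then 1 else 0)"
    "\<forall>x\<in>B. x = (\<Sum>e\<in>E. cinner x e *\<^sub>C e)" by blast
  have "subspace {x. x = (\<Sum>e\<in>E. cinner x e *\<^sub>C e)}"
    by (auto simp: subspace_def cinner_simps scaleC_add_left sum.distrib scaleR_scaleC
        scaleC_scaleC[symmetric] bounded_bilinear.sum_right[OF bounded_bilinear_scaleC, symmetric])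
  then have "span B \<subseteq> {x. x = (\<Sum>e\<in>E. cinner x e *\<^sub>C e)}"
    using E(4) by (intro span_minimal subsetI CollectI) (blast, assumption)
  then have "\<forall>x\<in>X. (\<Sum>e\<in>E. cinner x e *\<^sub>C e) = x" using B(2) by auto
  then show ?thesis using E(1-3) by (intro exI[of _ E] conjI)
qed

lemma cproj:
  assumes "csubspace (X::'a::fd_chilbert set)"
  shows cproj_mem: "cproj X x \<in> X"
    and cproj_orth: "x - cproj X x \<in> orth X"
    and cproj_eqI: "\<And>y. y \<in> X \<Longrightarrow> x - y \<in> orth X \<Longrightarrow> cproj X x = y"
proof -
  obtain E where E: "finite E" "E \<subseteq> X" "\<forall>e\<in>E. \<forall>f\<in>E. cinner e f = (if e = f then 1 else 0)"
     "\<forall>x\<in>X. (\<Sum>e\<in>E. cinner x e *\<^sub>C e) = x"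
    using orthonormal_basis_exists[OF assms] by blast
  let ?y = "\<Sum>e\<in>E. cinner x e *\<^sub>C e"
  have y: "?y \<in> X"
    using E(1,2) csubspace_0[OF assms] csubspace_add[OF assms] csubspace_scaleC[OF assms]
    by (induction E) auto
  have eq: "cinner (x - ?y) f = 0" if "f \<in> E" for f
  proof -
    have "cinner ?y f = (\<Sum>e\<in>E. if e = f then cinner x e else 0)"
      unfolding cinner_sum_left using E(3) that by (intro sum.cong) (auto simp: cinner_simps)
    then show ?thesis using E(1) that by (simp add: cinner_simps)
  qed
  have "x - ?y \<in> orth X"
    unfolding orth_def
  proof safe
    fix z assume "z \<in> X"
    have "cinner (\<Sum>e\<in>E. cinner z e *\<^sub>C e) (x - ?y) = 0"
      unfolding cinner_sum_left
    proof (intro sum.neutral ballI)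
      fix e assume "e \<in> E"
      then show "cinner (cinner z e *\<^sub>C e) (x - ?y) = 0"
        using eq[of e] cinner_commute[of e "x - ?y"] by (simp add: cinner_scaleC_left)
    qed
    then show "cinner (x - ?y) z = 0"
      using E(4)[rule_format, OF \<open>z \<in> X\<close>] cinner_commute[of "x - ?y" z] by (metis complex_cnj_zero)
  qed
  moreover have uniq: "y = z" if "y \<in> X" "x - y \<in> orth X" "z \<in> X" "x - z \<in> orth X" for y z
  proof -
    have "y - z \<in> X" using assms that by (simp add: csubspace_diff)
    then have "cinner (x - z) (y - z) = 0" "cinner (x - y) (y - z) = 0" using that by (auto simp: orth_def)
    then have "cinner ((x - z) - (x - y)) (y - z) = 0" unfolding cinner_diff_left[of "x - z"] by simp
    then show ?thesis by simp
  qed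
  ultimately have ex: "\<exists>!y. y \<in> X \<and> x - y \<in> orth X" using y by blast
  show "cproj X x \<in> X" "x - cproj X x \<in> orth X"
    unfolding cproj_def using theI'[OF ex] by auto
  then show "\<And>y. y \<in> X \<Longrightarrow> x - y \<in> orth X \<Longrightarrow> cproj X x = y" using uniq by blast
qed

lemma orthD: "y \<in> orth X \<Longrightarrow> x \<in> X \<Longrightarrow> cinner y x = 0"
  "y \<in> orth X \<Longrightarrow> x \<in> X \<Longrightarrow> cinner x y = 0"
  using cinner_commute[of x y] by (auto simp: orth_def)

lemma cproj_id: "csubspace X \<Longrightarrow> x \<in> X \<Longrightarrow> cproj X x = x"
  by (rule cproj_eqI) (auto simp: orth_def)

lemma cproj_zero: "csubspace X \<Longrightarrow> x \<in> orth X \<Longrightarrow> cproj X x = 0"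
  by (rule cproj_eqI) (auto simp: csubspace_0)

lemma cproj_operators:
  assumes "csubspace X"
  shows "cproj X \<in> operators UNIV X"
proof -
  have "cproj X (x + y) = cproj X x + cproj X y" for x y
  proof (rule cproj_eqI[OF assms])
    have "x - cproj X x + (y - cproj X y) \<in> orth X"
      using assms by (intro csubspace_add csubspace_orth cproj_orth)
    then show "x + y - (cproj X x + cproj X y) \<in> orth X" by (simp add: algebra_simps)
  qed (use assms in \<open>auto intro: csubspace_add cproj_mem\<close>)
  moreover have "cproj X (c *\<^sub>C x) = c *\<^sub>C cproj X x" for c x
    using assms
    by (intro cproj_eqI[OF assms] csubspace_scaleC cproj_mem)
       (auto simp: scaleC_diff_right[symmetric] intro: csubspace_scaleC csubspace_orth cproj_orth)
  ultimately show ?thesis using assms by (auto simp: operators_def cproj_mem)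
qed

lemma cproj_orth_eq:
  assumes "csubspace X"
  shows "cproj (orth X) x = x - cproj X x"
proof (rule cproj_eqI[OF csubspace_orth cproj_orth[OF assms]])
  show "x - (x - cproj X x) \<in> orth (orth X)"
    using orthD(2)[OF _ cproj_mem[OF assms, of x]] by (simp add: orth_def[of "orth X"])
qed

lemma cinner_cproj_left:
  assumes "csubspace X" "y \<in> X"
  shows "cinner (cproj X x) y = cinner x y"
  using orthD(1)[OF cproj_orth[OF assms(1)] assms(2), of x] by (simp add: cinner_simps)

lemma cinner_cproj_right:
  assumes "csubspace X" "y \<in> X"
  shows "cinner y (cproj X x) = cinner y x"
  using cinner_cproj_left[OF assms, of x] by (metis cinner_commute)

lemma riesz_representation:
  assumes X: "csubspace (X::'a::fd_chilbert set)"
    and add: "\<And>x y. x \<in> X \<Longrightarrow> y \<in> X \<Longrightarrow> \<phi> (x + y) = \<phi> x + \<phi> y"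
    and scale: "\<And>c x. x \<in> X \<Longrightarrow> \<phi> (c *\<^sub>C x) = c * \<phi> x"
  shows "\<exists>z\<in>X. \<forall>x\<in>X. \<phi> x = cinner x z"
proof -
  obtain E where E: "finite E" "E \<subseteq> X" "\<forall>x\<in>X. (\<Sum>e\<in>E. cinner x e *\<^sub>C e) = x"
    using orthonormal_basis_exists[OF X] by blast
  have phi0: "\<phi> 0 = 0" using scale[of 0 0] csubspace_0[OF X] by simp
  have sum: "\<phi> (\<Sum>e\<in>F. c e *\<^sub>C e) = (\<Sum>e\<in>F. c e * \<phi> e) \<and> (\<Sum>e\<in>F. c e *\<^sub>C e) \<in> X"
    if "finite F" "F \<subseteq> X" for F c
    using that by (induction F) (auto simp: phi0 csubspace_0[OF X] add scale csubspace_add[OF X]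
        csubspace_scaleC[OF X])
  define z where "z = (\<Sum>e\<in>E. cnj (\<phi> e) *\<^sub>C e)"
  have "\<phi> x = cinner x z" if "x \<in> X" for x
  proof -
    have "\<phi> x = (\<Sum>e\<in>E. cinner x e * \<phi> e)" using sum[OF E(1,2)] E(3) that by metis
    also have "\<dots> = cnj (cinner z x)"
      by (simp add: z_def cinner_sum_left cinner_scaleC_left cinner_commute[of x] mult.commute)
    finally show ?thesis using cinner_commute[of x z] by simp
  qed
  moreover have "z \<in> X" unfolding z_def using sum[OF E(1,2), of "\<lambda>e. cnj (\<phi> e)"] by simp
  ultimately show ?thesis by blast
qed

lemma cadj:
  assumes X: "csubspace (X::'a::fd_chilbert set)"
    and A: "A \<in> operators X Z"
  shows cadj_mem: "cadj X Y A y \<in> X"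
    and cadj_cinner: "\<And>x. x \<in> X \<Longrightarrow> cinner x (cadj X Y A y) = cinner (A x) (y::'b::fd_chilbert)"
    and cadj_eqI: "\<And>z. z \<in> X \<Longrightarrow> (\<And>x. x \<in> X \<Longrightarrow> cinner (A x) y = cinner x z) \<Longrightarrow> cadj X Y A y = z"
proof -
  have "\<exists>z\<in>X. \<forall>x\<in>X. cinner (A x) y = cinner x z"
    by (rule riesz_representation[OF X]) (auto simp: operatorsD[OF A] cinner_simps)
  moreover have uniq: "z = z'"
    if "z \<in> X" "z' \<in> X" "\<And>x. x \<in> X \<Longrightarrow> cinner (A x) y = cinner x z"
      "\<And>x. x \<in> X \<Longrightarrow> cinner (A x) y = cinner x z'" for z z'
  proof -
    have "z - z' \<in> X" using X that by (simp add: csubspace_diff)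
    then have "cinner (z - z') (z - z') = 0"
      using that(3,4)[of "z - z'"] by (simp add: cinner_diff_right)
    then show ?thesis by simp
  qed
  ultimately have ex: "\<exists>!z. z \<in> X \<and> (\<forall>x\<in>X. cinner (A x) y = cinner x z)" by blast
  show "cadj X Y A y \<in> X" "\<And>x. x \<in> X \<Longrightarrow> cinner x (cadj X Y A y) = cinner (A x) y"
    unfolding cadj_def using theI'[OF ex] by auto
  then show "\<And>z. z \<in> X \<Longrightarrow> (\<And>x. x \<in> X \<Longrightarrow> cinner (A x) y = cinner x z) \<Longrightarrow> cadj X Y A y = z"
    using uniq by metis
qed

text \<open>
  An injective operator maps a real basis to an independent set of the same size, and a finite-dimensional
  space has no larger independent set.
\<close>

lemma injective_operator_surjective:
  fixes A :: "'a::fd_chilbert \<Rightarrow> 'a"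
  assumes A: "A \<in> operators UNIV UNIV" and "\<And>x. A x = 0 \<Longrightarrow> x = 0"
  shows "bij A"
proof -
  have lin: "linear A"
    using operatorsD(2,3)[OF A] by (intro linearI) (auto simp: scaleR_scaleC)
  then have inj: "inj A" using assms(2) by (auto simp: linear_injective_0)
  obtain B :: "'a set" where B: "finite B" "independent B" "span B = UNIV"
    using finite_real_basis[OF csubspace_UNIV] by blast
  have ind: "independent (A ` B)"
    using lin B(2) inj_on_subset[OF inj] by (intro linear_independent_injective_image) auto
  have "y \<in> span (A ` B)" for y
  proof (rule ccontr)
    assume y: "y \<notin> span (A ` B)"
    then have "independent (insert y (A ` B))" using ind by (simp add: independent_insert)
    then have "card (insert y (A ` B)) \<le> card B"
      using independent_span_bound[OF B(1)] B(3) by auto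
    moreover have "y \<notin> A ` B" using y span_base[of y "A ` B"] by auto
    moreover have "card (A ` B) = card B" using inj by (intro card_image) (auto intro: inj_on_subset)
    ultimately show False using B(1) by simp
  qed
  then have "surj A" using linear_span_image[OF lin, of B] B(3) by auto
  then show ?thesis using inj by (simp add: bij_def)
qed

section \<open>Boundary parameters\<close>

lemma cadj_operators:
  assumes X: "csubspace X" and A: "A \<in> operators X Y"
  shows "cadj X Z A \<in> operators UNIV X"
proof -
  note adj = cadj[OF X A]
  have "cadj X Z A (x + y) = cadj X Z A x + cadj X Z A y" for x y
    by (rule adj(3)) (auto intro!: csubspace_add[OF X] adj(1) simp: cinner_simps adj(2))
  moreover have "cadj X Z A (c *\<^sub>C x) = c *\<^sub>C cadj X Z A x" for c x
    by (rule adj(3)) (auto intro!: csubspace_scaleC[OF X] adj(1) simp: cinner_simps adj(2))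
  ultimately show ?thesis using adj(1) by (auto simp: operators_def)
qed

lemma cinner_op_Im:
  assumes X: "csubspace X" and A: "A \<in> operators X X" and "x \<in> X"
  shows "cinner (op_Im X A x) x = complex_of_real (Im (cinner (A x) x))"
proof -
  note adj = cadj[OF X A]
  have "cinner (cadj X X A x) x = cnj (cinner (A x) x)"
    using adj(2)[OF \<open>x \<in> X\<close>, of _ x] cinner_commute[of "cadj X X A x" x] by simp
  then show ?thesis
    by (simp add: op_Im_def cinner_simps complex_eq_iff)
qed

lemma boundary_param_tau0:
  assumes K: "csubspace (K::'b::fd_chilbert set)"
  shows "boundary_param K (tau0 K)"
proof -
  have adj0: "cadj X Y (\<lambda>x::'b. 0::'b) y = 0" if "csubspace X" for X Y y
    using that by (intro cadj_eqI[of _ _ UNIV]) (auto simp: csubspace_0 operators_def)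
  have Im0: "op_Im X (\<lambda>x. 0) x = 0" if "csubspace X" for X and x :: 'b
    by (simp add: op_Im_def adj0[OF that])
  have adjP: "cadj (orth K) Y (\<lambda>x. x) x = cproj (orth K) x" for Y x
    by (intro cadj_eqI[of _ _ UNIV])
       (auto simp: csubspace_orth cproj_mem cinner_cproj_right operators_def)
  have adjPK: "cadj (orth K) Y (cproj K) x = 0" for Y x
    using K operators_mono[OF cproj_operators[OF K]]
    by (intro cadj_eqI[of _ _ K]) (auto simp: csubspace_orth csubspace_0 cproj_zero)
  have nonneg: "cinner (cproj (orth K) x) x \<in> \<real>\<^sub>\<ge>\<^sub>0" for x
  proof -
    have "cinner (cproj (orth K) x) x = complex_of_real ((norm (cproj (orth K) x))\<^sup>2)"
      using cinner_cproj_right[OF csubspace_orth cproj_mem[OF csubspace_orth], of K x x]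
      by (simp add: cinner_self)
    then show ?thesis by (simp only: nonneg_Reals_of_real_iff zero_le_power2)
  qed
  have bij: "bij_betw (cproj K) K K"
    using cproj_id[OF K] by (simp add: bij_betw_def inj_on_def)
  show ?thesis
    using K bij cproj_operators[OF K] nonneg
    by (auto simp: boundary_param_def tau0_def Im0 csubspace_UNIV adjP adjPK adj0 op_nonneg_def
        operators_def op_holomorphic_on_def boundedly_invertible_def csubspace_0 bij_betw_def
        operators_0[OF cproj_operators[OF K] csubspace_UNIV])
qed

text \<open>
  For \<open>h0 = a + c\<close> along \<open>K\<close> and its complement, the left-hand side of the claim is
  \<open>1/2 |a + i h1|\<^sup>2 - 1/2 |a - i h1|\<^sup>2 + |c|\<^sup>2\<close>. The kernel of \<open>(C0, C1)\<close> is the orthogonal complement of the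
  vectors \<open>(\<alpha>, \<gamma>, \<beta>)\<close> formed by the adjoints \<open>C01*\<close>, \<open>C02*\<close>, \<open>C1*\<close> at some \<open>g\<close>, and on these vectors the same
  form is nonnegative by the definition of a boundary parameter. The invertibility of \<open>C0 - i C1 P\<close> allows to
  choose \<open>g\<close> such that \<open>\<alpha> + i \<beta> = a + i h1\<close> and \<open>\<gamma> = c\<close>; then orthogonality, nonnegativity and
  \<open>0 \<le> |(a - i h1) + (\<alpha> - i \<beta>)|\<^sup>2\<close> combine linearly to the claim.
\<close>

lemma boundary_param_dissipative:
  assumes K: "csubspace K" and \<tau>: "boundary_param K \<tau>" and \<mu>: "Im \<mu> > 0"
    and h1: "h1 \<in> K" and ker: "C0 \<tau> \<mu> h0 + C1 \<tau> \<mu> h1 = 0"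
  shows "2 * Im (cinner h0 h1) + (norm (cproj (orth K) h0))\<^sup>2 \<le> 0"
proof -
  let ?C0 = "C0 \<tau> \<mu>" and ?C1 = "C1 \<tau> \<mu>"
  have C0: "?C0 \<in> operators UNIV UNIV" and C1: "?C1 \<in> operators K UNIV"
    and inv: "bij (\<lambda>x. ?C0 x - \<i> *\<^sub>C ?C1 (cproj K x))"
    and pos: "\<And>x. cinner (2 *\<^sub>C op_Im UNIV (\<lambda>x. ?C1 (cadj K UNIV ?C0 x)) x
          + ?C0 (cadj (orth K) UNIV ?C0 x)) x \<in> \<real>\<^sub>\<ge>\<^sub>0"
    using \<tau> \<mu> by (auto simp: boundary_param_def boundedly_invertible_def op_nonneg_def)
  note K' = csubspace_orth[of K]
  have P: "cproj K \<in> operators UNIV K" by (rule cproj_operators[OF K])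
  define X where "X = (\<lambda>x. ?C0 x - \<i> *\<^sub>C ?C1 (cproj K x))"
  have X: "X (x + y) = X x + X y" "X (c *\<^sub>C x) = c *\<^sub>C X x" for x y c
    using cproj_mem[OF K]
    by (auto simp: X_def operatorsD(2,3)[OF C0] operatorsD(2,3)[OF C1] operatorsD(2,3)[OF P]
        scaleC_add_right scaleC_diff_right scaleC_scaleC mult.commute)
  obtain Xi where Xi: "\<And>y. X (Xi y) = y" "\<And>x. Xi (X x) = x"
    using inv unfolding X_def[symmetric] by (metis bij_inv_eq_iff)
  define c where "c = cproj (orth K) h0"
  define a where "a = cproj K h0"
  have h0: "h0 = a + c" and a: "a \<in> K" and c: "c \<in> orth K"
    using K K' by (auto simp: a_def c_def cproj_orth_eq cproj_mem)
      (metis cproj_mem cproj_orth_eq K')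
  \<comment> \<open>\<open>g\<close> is the adjoint of the inverse of \<open>X\<close> at \<open>h0 + i h1\<close>, so the adjoint of \<open>X\<close> maps \<open>g\<close> to \<open>h0 + i h1\<close>.\<close>
  obtain g where g: "\<And>y. cinner (Xi y) (h0 + \<i> *\<^sub>C h1) = cinner y g"
  proof -
    have "Xi (y + z) = Xi y + Xi z" "Xi (k *\<^sub>C y) = k *\<^sub>C Xi y" for y z k
      using X Xi by metis+
    then have "\<exists>z\<in>UNIV. \<forall>y\<in>UNIV. cinner (Xi y) (h0 + \<i> *\<^sub>C h1) = cinner y z"
      by (intro riesz_representation csubspace_UNIV) (simp_all add: cinner_add_left cinner_scaleC_left)
    then show ?thesis using that by auto
  qed
  then have g: "cinner (X x) g = cinner x (h0 + \<i> *\<^sub>C h1)" for x using Xi by metis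
  define \<alpha> where "\<alpha> = cadj K UNIV ?C0 g"
  define \<beta> where "\<beta> = cadj K UNIV ?C1 g"
  define \<gamma> where "\<gamma> = cadj (orth K) UNIV ?C0 g"
  have C0': "?C0 \<in> operators K UNIV" "?C0 \<in> operators (orth K) UNIV"
    using operators_mono[OF C0] by auto
  have \<alpha>: "\<alpha> \<in> K" "\<And>x. x \<in> K \<Longrightarrow> cinner (?C0 x) g = cinner x \<alpha>"
    unfolding \<alpha>_def by (auto simp: cadj[OF K C0'(1)])
  have \<beta>: "\<beta> \<in> K" "\<And>x. x \<in> K \<Longrightarrow> cinner (?C1 x) g = cinner x \<beta>"
    unfolding \<beta>_def by (auto simp: cadj[OF K C1])
  have \<gamma>: "\<gamma> \<in> orth K" "\<And>x. x \<in> orth K \<Longrightarrow> cinner (?C0 x) g = cinner x \<gamma>"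
    unfolding \<gamma>_def by (auto simp: cadj[OF K' C0'(2)])
  have p: "\<alpha> + \<i> *\<^sub>C \<beta> = a + \<i> *\<^sub>C h1"
  proof -
    let ?d = "\<alpha> + \<i> *\<^sub>C \<beta> - (a + \<i> *\<^sub>C h1)"
    have d: "?d \<in> K" using K a h1 \<alpha>(1) \<beta>(1) by (simp add: csubspace_add csubspace_diff csubspace_scaleC)
    have "cinner ?d (\<alpha> + \<i> *\<^sub>C \<beta>) = cinner (X ?d) g"
      using d K by (simp add: X_def cproj_id \<alpha>(2) \<beta>(2) cinner_diff_left cinner_scaleC_left
          cinner_add_right cinner_scaleC_right)
    also have "\<dots> = cinner ?d (a + \<i> *\<^sub>C h1)"
      unfolding g h0 using orthD(2)[OF c d] by (simp add: cinner_add_right)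
    finally have "cinner ?d ?d = 0" by (simp add: cinner_diff_right)
    then show ?thesis by simp
  qed
  have q: "\<gamma> = c"
  proof -
    have d: "\<gamma> - c \<in> orth K" using K' c \<gamma>(1) by (simp add: csubspace_diff)
    have "cinner (\<gamma> - c) \<gamma> = cinner (X (\<gamma> - c)) g"
      using d K by (simp add: X_def cproj_zero operators_0[OF C1] \<gamma>(2))
    also have "\<dots> = cinner (\<gamma> - c) c"
      unfolding g h0 using orthD(1)[OF d a] orthD(1)[OF d h1] by (simp add: cinner_add_right cinner_scaleC_right)
    finally have "cinner (\<gamma> - c) (\<gamma> - c) = 0" by (simp add: cinner_diff_right)
    then show ?thesis by simp
  qed
  have pos': "2 * Im (cinner \<alpha> \<beta>) + (norm c)\<^sup>2 \<ge> 0"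
  proof -
    have "(\<lambda>x. ?C1 (cadj K UNIV ?C0 x)) \<in> operators UNIV UNIV"
      using cadj_operators[OF K C0'(1), of UNIV] C1 by (auto simp: operators_def)
    then have "cinner (op_Im UNIV (\<lambda>x. ?C1 (cadj K UNIV ?C0 x)) g) g
        = complex_of_real (Im (cinner (?C1 \<alpha>) g))"
      by (simp add: cinner_op_Im csubspace_UNIV \<alpha>_def)
    moreover have "cinner (?C0 \<gamma>) g = complex_of_real ((norm \<gamma>)\<^sup>2)"
      using \<gamma> by (simp add: cinner_self)
    ultimately have "complex_of_real (2 * Im (cinner \<alpha> \<beta>) + (norm \<gamma>)\<^sup>2) \<in> \<real>\<^sub>\<ge>\<^sub>0"
      using pos[of g] \<alpha> \<beta>(2)[OF \<alpha>(1)] by (simp add: cinner_simps \<gamma>_def[symmetric])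
    then show ?thesis by (simp only: nonneg_Reals_of_real_iff q)
  qed
  have ort: "inner a \<alpha> + inner h1 \<beta> + (norm c)\<^sup>2 = 0"
  proof -
    have "cinner a \<alpha> + cinner c \<gamma> + cinner h1 \<beta> = cinner (?C0 h0 + ?C1 h1) g"
      using a c h1 \<alpha>(2) \<beta>(2) \<gamma>(2) by (simp add: h0 operatorsD(2)[OF C0] cinner_simps)
    then have "Re (cinner a \<alpha> + cinner c c + cinner h1 \<beta>) = 0" by (simp add: ker q)
    then show ?thesis by (simp add: inner_eq_Re_cinner power2_norm_eq_inner)
  qed
  have norm_plus: "(norm (x + \<i> *\<^sub>C y))\<^sup>2 = (norm x)\<^sup>2 + (norm y)\<^sup>2 + 2 * Im (cinner x y)"
    and norm_minus: "(norm (x - \<i> *\<^sub>C y))\<^sup>2 = (norm x)\<^sup>2 + (norm y)\<^sup>2 - 2 * Im (cinner x y)" for x y :: 'a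
    using cinner_commute[of y x]
    by (auto simp: power2_norm_eq_inner inner_eq_Re_cinner cinner_simps)
  \<comment> \<open>Polarization turns the orthogonality relation into one between the plus and minus combinations.\<close>
  define S where "S = inner (a - \<i> *\<^sub>C h1) (\<alpha> - \<i> *\<^sub>C \<beta>)"
  have "2 * (inner a \<alpha> + inner h1 \<beta>) = inner (a + \<i> *\<^sub>C h1) (\<alpha> + \<i> *\<^sub>C \<beta>) + S"
    by (simp add: S_def inner_eq_Re_cinner cinner_simps)
  then have pol: "2 * (inner a \<alpha> + inner h1 \<beta>) = (norm (a + \<i> *\<^sub>C h1))\<^sup>2 + S"
    unfolding p by (simp only: power2_norm_eq_inner)
  have "(norm (a - \<i> *\<^sub>C h1 + (\<alpha> - \<i> *\<^sub>C \<beta>)))\<^sup>2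
      = (norm (a - \<i> *\<^sub>C h1))\<^sup>2 + (norm (\<alpha> - \<i> *\<^sub>C \<beta>))\<^sup>2 + 2 * S"
    by (simp add: S_def power2_norm_eq_inner inner_add inner_commute)
  then have sq: "0 \<le> (norm (a - \<i> *\<^sub>C h1))\<^sup>2 + (norm (\<alpha> - \<i> *\<^sub>C \<beta>))\<^sup>2 + 2 * S"
    by (metis zero_le_power2)
  have "2 * Im (cinner a h1) + (norm c)\<^sup>2 \<le> 0"
  proof -
    have "(2 * Ia + c2 \<le> 0)" if "0 \<le> 2 * Ib + c2" "R + c2 = 0" "2 * R = P + S" "0 \<le> m + m' + 2 * S"
      "P = A + B + 2 * Ib" "P = A' + B' + 2 * Ia" "m = A' + B' - 2 * Ia" "m' = A + B - 2 * Ib"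
      for Ia Ib c2 R P S m m' A B A' B' :: real
      using that by linarith
    from this[OF pos' ort pol sq norm_plus[of \<alpha> \<beta>, unfolded p] norm_plus norm_minus norm_minus]
    show ?thesis .
  qed
  moreover have "cinner h0 h1 = cinner a h1" using orthD(1)[OF c h1] by (simp add: h0 cinner_simps)
  ultimately show ?thesis by (simp add: c_def)
qed

section \<open>Absolutely continuous functions\<close>

lemma abs_cont_onE:
  assumes "abs_cont_on X y" "\<epsilon> > 0"
  obtains \<delta> where "\<delta> > 0" "\<And>D. D division_of \<Union>D \<Longrightarrow> \<Union>D \<subseteq> X \<Longrightarrow> (\<Sum>K\<in>D. Sup K - Inf K) < \<delta>
    \<Longrightarrow> (\<Sum>K\<in>D. norm (y (Sup K) - y (Inf K))) < \<epsilon>"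
proof -
  from assms(1)[unfolded abs_cont_on_def, rule_format, OF assms(2)]
  show thesis by (elim exE conjE) (rule that, assumption, simp)
qed

lemma abs_cont_on_subset: "abs_cont_on X y \<Longrightarrow> X' \<subseteq> X \<Longrightarrow> abs_cont_on X' y"
  unfolding abs_cont_on_def by (meson subset_trans)

lemma abs_cont_on_bound:
  assumes y: "abs_cont_on X y" and z: "abs_cont_on X z"
    and le: "\<And>s t. s \<in> X \<Longrightarrow> t \<in> X \<Longrightarrow> norm (g t - g s) \<le> C * (norm (y t - y s) + norm (z t - z s))"
  shows "abs_cont_on X g"
  unfolding abs_cont_on_def
proof (intro allI impI)
  fix \<epsilon> :: real assume \<epsilon>: "\<epsilon> > 0"
  let ?\<eta> = "\<epsilon> / (2 * (\<bar>C\<bar> + 1))"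
  have \<eta>: "?\<eta> > 0" using \<epsilon> by (simp add: add_nonneg_pos)
  obtain \<delta>1 where \<delta>1: "\<delta>1 > 0" "\<And>D. D division_of \<Union>D \<Longrightarrow> \<Union>D \<subseteq> X
      \<Longrightarrow> (\<Sum>K\<in>D. Sup K - Inf K) < \<delta>1 \<Longrightarrow> (\<Sum>K\<in>D. norm (y (Sup K) - y (Inf K))) < ?\<eta>"
    by (rule abs_cont_onE[OF y \<eta>]) (rule that, assumption, blast)
  obtain \<delta>2 where \<delta>2: "\<delta>2 > 0" "\<And>D. D division_of \<Union>D \<Longrightarrow> \<Union>D \<subseteq> X
      \<Longrightarrow> (\<Sum>K\<in>D. Sup K - Inf K) < \<delta>2 \<Longrightarrow> (\<Sum>K\<in>D. norm (z (Sup K) - z (Inf K))) < ?\<eta>"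
    by (rule abs_cont_onE[OF z \<eta>]) (rule that, assumption, blast)
  have "(\<Sum>K\<in>D. norm (g (Sup K) - g (Inf K))) < \<epsilon>"
    if D: "D division_of \<Union>D" "\<Union>D \<subseteq> X" "(\<Sum>K\<in>D. Sup K - Inf K) < min \<delta>1 \<delta>2" for D
  proof -
    let ?y = "\<Sum>K\<in>D. norm (y (Sup K) - y (Inf K))" and ?z = "\<Sum>K\<in>D. norm (z (Sup K) - z (Inf K))"
    have "norm (g (Sup K) - g (Inf K))
        \<le> (\<bar>C\<bar> + 1) * (norm (y (Sup K) - y (Inf K)) + norm (z (Sup K) - z (Inf K)))"
      if K: "K \<in> D" for K
    proof -
      obtain u v where "K = cbox u v" "K \<noteq> {}" "K \<subseteq> X"
        using division_ofD(2-4)[OF D(1)] K D(2) by (metis Union_upper subset_trans)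
      then have "Sup K \<in> X" "Inf K \<in> X" by auto
      from le[OF this(2,1)] show ?thesis
        by (rule order_trans) (intro mult_right_mono, auto)
    qed
    then have "(\<Sum>K\<in>D. norm (g (Sup K) - g (Inf K)))
        \<le> (\<Sum>K\<in>D. (\<bar>C\<bar> + 1) * (norm (y (Sup K) - y (Inf K)) + norm (z (Sup K) - z (Inf K))))"
      by (rule sum_mono)
    also have "\<dots> = (\<bar>C\<bar> + 1) * (?y + ?z)"
      by (simp only: sum_distrib_left[symmetric] sum.distrib)
    also have "\<dots> < (\<bar>C\<bar> + 1) * (?\<eta> + ?\<eta>)"
      using \<delta>1(2)[OF D(1,2)] \<delta>2(2)[OF D(1,2)] D(3)
      by (intro mult_strict_left_mono add_strict_mono) auto
    also have "\<dots> = \<epsilon>" by (simp add: field_simps add_nonneg_eq_0_iff)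
    finally show ?thesis .
  qed
  then show "\<exists>\<delta>>0. \<forall>D. D division_of \<Union>D \<and> \<Union>D \<subseteq> X \<and> (\<Sum>K\<in>D. Sup K - Inf K) < \<delta>
      \<longrightarrow> (\<Sum>K\<in>D. norm (g (Sup K) - g (Inf K))) < \<epsilon>"
    using \<delta>1(1) \<delta>2(1) by (intro exI[of _ "min \<delta>1 \<delta>2"]) auto
qed

lemma abs_cont_on_imp_continuous_on:
  assumes "abs_cont_on {a..b} y"
  shows "continuous_on {a..b} y"
  unfolding continuous_on_iff
proof (intro ballI allI impI)
  fix t e :: real assume t: "t \<in> {a..b}" and e: "e > 0"
  obtain \<delta> where \<delta>: "\<delta> > 0" "\<And>D. D division_of \<Union>D \<Longrightarrow> \<Union>D \<subseteq> {a..b} \<Longrightarrow> (\<Sum>K\<in>D. Sup K - Inf K) < \<delta>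
      \<Longrightarrow> (\<Sum>K\<in>D. norm (y (Sup K) - y (Inf K))) < e"
    by (rule abs_cont_onE[OF assms e]) (rule that, assumption, blast)
  have "dist (y s) (y t) < e" if s: "s \<in> {a..b}" "dist s t < \<delta>" for s
  proof -
    define u where "u = min s t"
    define v where "v = max s t"
    have uv: "u \<le> v" by (simp add: u_def v_def)
    have "{cbox u v} division_of \<Union>{cbox u v}" using uv division_of_self[of u v] by simp
    from \<delta>(2)[OF this] have "norm (y v - y u) < e"
      using uv s t by (auto simp: u_def v_def dist_real_def min_def max_def split: if_splits)
    then show ?thesis by (auto simp: u_def v_def dist_norm norm_minus_commute min_def max_def split: if_splits)
  qed
  then show "\<exists>d>0. \<forall>s\<in>{a..b}. dist s t < d \<longrightarrow> dist (y s) (y t) < e" using \<delta>(1) by blast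
qed

text \<open>
  A Henstock-Kurzweil form of the fundamental theorem for absolutely continuous functions. The gauge controls the
  difference quotient at points outside \<open>N\<close>, and keeps the cells tagged in \<open>N\<close> inside an open set of small measure; by
  absolute continuity these cells contribute little to the increment.
\<close>

lemma abs_cont_fundamental_theorem:
  fixes q :: "real \<Rightarrow> real"
  assumes "a \<le> b" and ac: "abs_cont_on {a..b} q" and N: "negligible N"
    and der: "\<And>x. x \<in> {a..b} - N \<Longrightarrow> (q has_vector_derivative f x) (at x within {a..b})"
  shows "(f has_integral (q b - q a)) {a..b}"
proof (cases "a = b")
  case True
  then show ?thesis by (simp add: has_integral_refl)
next
  case False
  then have ab: "a < b" using \<open>a \<le> b\<close> by simp
  define g where "g = (\<lambda>x. if x \<in> N then 0 else f x)"
  have "(g has_integral (q b - q a)) {a..b}"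
    unfolding has_integral_factor_content_real
  proof (intro allI impI)
    fix e :: real assume e: "e > 0"
    have "\<forall>x. \<exists>d>0. x \<in> {a..b} - N \<longrightarrow>
         (\<forall>y\<in>{a..b}. norm (y - x) < d \<longrightarrow> norm (q y - q x - (y - x) *\<^sub>R f x) \<le> (e / 2) * norm (y - x))"
      using der[unfolded has_vector_derivative_def has_derivative_within_alt] half_gt_zero[OF e]
      by (metis zero_less_one)
    then obtain d where d: "\<And>x. 0 < d x"
      "\<And>x y. x \<in> {a..b} - N \<Longrightarrow> y \<in> {a..b} \<Longrightarrow> norm (y - x) < d x
         \<Longrightarrow> norm (q y - q x - (y - x) *\<^sub>R f x) \<le> (e / 2) * norm (y - x)"
      by metis
    have pos: "e / 2 * (b - a) > 0" using e ab by simp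
    obtain \<delta> where \<delta>: "\<delta> > 0" "\<And>D. D division_of \<Union>D \<Longrightarrow> \<Union>D \<subseteq> {a..b} \<Longrightarrow> (\<Sum>K\<in>D. Sup K - Inf K) < \<delta>
        \<Longrightarrow> (\<Sum>K\<in>D. norm (q (Sup K) - q (Inf K))) < e / 2 * (b - a)"
      by (rule abs_cont_onE[OF ac pos]) (rule that, assumption, blast)
    obtain T where T: "open T" "N \<subseteq> T" "T - N \<in> lmeasurable" "emeasure lebesgue (T - N) < ennreal \<delta>"
      using sets_lebesgue_outer_open[OF negligible_imp_sets[OF N] \<delta>(1)] by blast
    define \<gamma> where "\<gamma> x = (if x \<in> N then T else ball x (d x))" for x
    have gauge: "gauge \<gamma>"
      using T(1,2) d(1) by (auto simp: gauge_def \<gamma>_def)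
    show "\<exists>d. gauge d \<and> (\<forall>p. p tagged_division_of {a..b} \<and> d fine p \<longrightarrow>
        norm ((\<Sum>(x, k)\<in>p. measure lborel k *\<^sub>R g x) - (q b - q a)) \<le> e * measure lborel {a..b})"
    proof (intro exI conjI allI impI, rule gauge)
      fix p assume "p tagged_division_of {a..b} \<and> \<gamma> fine p"
      then have ptag: "p tagged_division_of {a..b}" and fine: "\<gamma> fine p" by auto
      note fin = tagged_division_ofD(1)[OF ptag]
      define pN where "pN = {xk \<in> p. fst xk \<in> N}"
      have ba: "b - a = (\<Sum>(x,K)\<in>p. Sup K - Inf K)" "q b - q a = (\<Sum>(x,K)\<in>p. q (Sup K) - q (Inf K))"
        using additive_tagged_division_1[OF \<open>a \<le> b\<close> ptag, of "\<lambda>x. x"]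
          additive_tagged_division_1[OF \<open>a \<le> b\<close> ptag, of q] by auto
      have cell: "\<exists>u v. K = {u..v} \<and> u \<le> x \<and> x \<le> v \<and> a \<le> u \<and> v \<le> b" if "(x, K) \<in> p" for x K
        using tagged_division_ofD(2-4)[OF ptag that] by fastforce
      have good: "norm (measure lborel K *\<^sub>R g x - (q (Sup K) - q (Inf K))) \<le> e / 2 * (Sup K - Inf K)"
        if xK: "(x, K) \<in> p" "x \<notin> N" for x K
      proof -
        obtain u v where uv: "K = {u..v}" "u \<le> x" "x \<le> v" "a \<le> u" "v \<le> b" using cell[OF xK(1)] by blast
        have "K \<subseteq> \<gamma> x" using fine xK(1) by (auto simp: fine_def)
        then have "K \<subseteq> ball x (d x)" using xK(2) by (simp add: \<gamma>_def)
        then have "norm (u - x) < d x" "norm (v - x) < d x"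
          using uv subsetD[of K "ball x (d x)" u] subsetD[of K "ball x (d x)" v]
          by (auto simp: dist_real_def)
        then have "norm (q u - q x - (u - x) *\<^sub>R f x) \<le> (e / 2) * norm (u - x)"
          "norm (q v - q x - (v - x) *\<^sub>R f x) \<le> (e / 2) * norm (v - x)"
          using uv xK(2) d(2)[of x u] d(2)[of x v] by auto
        moreover have "norm ((v - u) *\<^sub>R f x - (q v - q u))
            \<le> norm (q u - q x - (u - x) *\<^sub>R f x) + norm (q v - q x - (v - x) *\<^sub>R f x)"
          by (rule order_trans[OF _ norm_triangle_ineq4]) (simp add: algebra_simps)
        ultimately have "norm ((v - u) *\<^sub>R f x - (q v - q u)) \<le> e / 2 * norm (u - x) + e / 2 * norm (v - x)"
          by linarith
        also have "\<dots> = e / 2 * (v - u)"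
          using uv by (simp add: field_simps)
        finally show ?thesis
          using uv xK(2) by (simp add: g_def)
      qed
      have bad: "(\<Sum>(x,K)\<in>pN. norm (q (Sup K) - q (Inf K))) < e / 2 * (b - a)"
      proof -
        have pt: "pN tagged_partial_division_of {a..b}"
          using ptag tagged_partial_division_subset[of p "{a..b}" pN]
          by (auto simp: tagged_division_of_def pN_def)
        let ?D = "snd ` pN"
        note D = partial_division_of_tagged_division[OF pt]
        have "(\<Sum>(x,K)\<in>pN. norm (q (Sup K) - q (Inf K))) = (\<Sum>K\<in>?D. norm (q (Sup K) - q (Inf K)))"
        proof -
          \<comment> \<open>The value at the empty cell has to be made zero, as \<open>Sup\<close> and \<open>Inf\<close> of the empty set may differ.\<close>
          let ?h = "\<lambda>K. if K = {} then 0 else norm (q (Sup K) - q (Inf K))"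
          have "(\<Sum>(x,K)\<in>pN. norm (q (Sup K) - q (Inf K))) = (\<Sum>(x,K)\<in>pN. ?h K)"
            using cell by (intro sum.cong) (auto simp: pN_def, fastforce)
          also have "\<dots> = (\<Sum>K\<in>?D. ?h K)"
            by (rule sum.over_tagged_division_lemma[OF tagged_partial_division_of_Union_self[OF pt]])
               (auto simp: not_less le_less)
          also have "\<dots> = (\<Sum>K\<in>?D. norm (q (Sup K) - q (Inf K)))"
            using cell by (intro sum.cong) (auto simp: pN_def, fastforce)
          finally show ?thesis .
        qed
        also have "\<dots> < e / 2 * (b - a)"
        proof (rule \<delta>(2)[OF D])
          show "\<Union>?D \<subseteq> {a..b}" using tagged_division_ofD(3)[OF ptag] unfolding pN_def by fastforce
          have "(\<Sum>K\<in>?D. Sup K - Inf K) = (\<Sum>K\<in>?D. measure lebesgue K)"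
          proof (rule sum.cong)
            fix K assume "K \<in> ?D"
            then obtain x where "(x, K) \<in> p" by (auto simp: pN_def)
            from cell[OF this] show "Sup K - Inf K = measure lebesgue K" by auto
          qed simp
          also have "\<dots> = measure lebesgue (\<Union>?D)" by (rule content_division[OF D])
          also have "\<dots> < \<delta>"
          proof -
            have "K \<subseteq> T" if "(x, K) \<in> pN" for x K
              using fine that by (auto simp: fine_def pN_def \<gamma>_def dest!: bspec[of p])
            then have "\<Union>?D \<subseteq> T" by fastforce
            then have "emeasure lebesgue (\<Union>?D) \<le> emeasure lebesgue T"
              using T(1) by (intro emeasure_mono) auto
            also have "\<dots> = emeasure lebesgue (T - N)"
              using N T(1) by (intro emeasure_Diff_null_set[symmetric]) (auto simp: negligible_iff_null_sets)
            also have "\<dots> < ennreal \<delta>" by (rule T(4))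
            finally show ?thesis
              using lmeasurable_division[OF D] by (simp add: emeasure_eq_measure2 ennreal_less_iff)
          qed
          finally show "(\<Sum>K\<in>?D. Sup K - Inf K) < \<delta>" .
        qed
        finally show ?thesis .
      qed
      have "norm ((\<Sum>(x, k)\<in>p. measure lborel k *\<^sub>R g x) - (q b - q a))
          = norm (\<Sum>(x, K)\<in>p. measure lborel K *\<^sub>R g x - (q (Sup K) - q (Inf K)))"
        by (simp add: ba(2) sum_subtractf case_prod_unfold)
      also have "\<dots> \<le> (\<Sum>(x, K)\<in>p. norm (measure lborel K *\<^sub>R g x - (q (Sup K) - q (Inf K))))"
        by (rule order_trans[OF norm_sum]) (simp add: case_prod_unfold)
      also have "\<dots> = (\<Sum>(x, K)\<in>p - pN. norm (measure lborel K *\<^sub>R g x - (q (Sup K) - q (Inf K))))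
          + (\<Sum>(x, K)\<in>pN. norm (measure lborel K *\<^sub>R g x - (q (Sup K) - q (Inf K))))"
        by (rule sum.subset_diff) (use fin in \<open>auto simp: pN_def\<close>)
      also have "(\<Sum>(x, K)\<in>pN. norm (measure lborel K *\<^sub>R g x - (q (Sup K) - q (Inf K))))
          = (\<Sum>(x, K)\<in>pN. norm (q (Sup K) - q (Inf K)))"
        by (rule sum.cong) (auto simp: pN_def g_def abs_minus_commute)
      also have "(\<Sum>(x, K)\<in>p - pN. norm (measure lborel K *\<^sub>R g x - (q (Sup K) - q (Inf K))))
          \<le> (\<Sum>(x, K)\<in>p - pN. e / 2 * (Sup K - Inf K))"
        using good by (intro sum_mono) (auto simp: pN_def)
      also have "\<dots> \<le> (\<Sum>(x, K)\<in>p. e / 2 * (Sup K - Inf K))"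
        using fin e cell by (intro sum_mono2) (auto, fastforce)
      also have "\<dots> = e / 2 * (b - a)"
        by (simp add: ba(1) sum_distrib_left case_prod_unfold)
      also have "e / 2 * (b - a) + (\<Sum>(x, K)\<in>pN. norm (q (Sup K) - q (Inf K))) \<le> e * measure lborel {a..b}"
        using bad \<open>a \<le> b\<close> by (simp add: field_simps)
      finally show "norm ((\<Sum>(x, k)\<in>p. measure lborel k *\<^sub>R g x) - (q b - q a)) \<le> e * measure lborel {a..b}"
        by simp
    qed
  qed
  then show ?thesis
    by (rule has_integral_spike[OF N, rotated]) (auto simp: g_def)
qed

section \<open>Square integrable solutions\<close>

lemma op_nonnegD:
  assumes "op_nonneg UNIV A"
  shows "Re (cinner (A x) x) \<ge> 0" and "Im (cinner (A x) x) = 0"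
  using assms unfolding op_nonneg_def complex_nonneg_Reals_iff by blast+

text \<open>
  The form of \<open>A\<close> at \<open>y + s A y\<close>, with \<open>s\<close> real or \<open>s = i\<close>, is real and nonnegative. The value \<open>s = i\<close> yields
  \<open>Re (A A y, y) = |A y|\<^sup>2\<close>, which replaces the selfadjointness of \<open>A\<close>, and small negative real \<open>s\<close> would give a
  negative value unless \<open>A y = 0\<close>.
\<close>

lemma operator_nonneg_eq_0:
  assumes A: "A \<in> operators UNIV UNIV" and pos: "op_nonneg UNIV A" and 0: "Re (cinner (A y) y) = 0"
  shows "A y = 0"
proof -
  define z where "z = A y"
  define c where "c = cinner (A z) y"
  define n where "n = (norm z)\<^sup>2"
  define d where "d = Re (cinner (A z) z)"
  have re: "Re (cinner (A x) x) \<ge> 0" and im: "Im (cinner (A x) x) = 0" for x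
    using op_nonnegD[OF pos] by blast+
  have ex: "cinner (A (y + s *\<^sub>C z)) (y + s *\<^sub>C z)
      = cinner (A y) y + cnj s * complex_of_real n + s * c + s * cnj s * cinner (A z) z" for s
    by (simp add: operatorsD(2,3)[OF A] cinner_simps z_def c_def n_def cinner_self algebra_simps)
  have r: "Re (cinner (A (y + complex_of_real r *\<^sub>C z)) (y + complex_of_real r *\<^sub>C z)) = r * (n + Re c) + r\<^sup>2 * d" for r
    unfolding ex by (simp add: 0 im d_def power2_eq_square algebra_simps)
  have i: "Im (cinner (A (y + \<i> *\<^sub>C z)) (y + \<i> *\<^sub>C z)) = Re c - n"
    unfolding ex by (simp add: im)
  have "Re c = n" using i im by simp
  have nn: "n \<ge> 0" by (simp add: n_def)
  have d: "d \<ge> 0" using re by (simp add: d_def)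
  have "n = 0"
  proof (rule ccontr)
    assume "n \<noteq> 0"
    then have n: "n > 0" using nn by simp
    define r where "r = - (n / (d + 1))"
    have "0 \<le> r * (n + Re c) + r\<^sup>2 * d" using re unfolding r[symmetric] by blast
    also have "\<dots> = r * (2 * n + r * d)"
      by (simp add: \<open>Re c = n\<close> power2_eq_square algebra_simps)
    also have "\<dots> < 0"
    proof (rule mult_neg_pos)
      show "r < 0" using n d by (simp add: r_def add_nonneg_pos)
      have "- (r * d) \<le> n" using n d by (simp add: r_def field_simps)
      then show "0 < 2 * n + r * d" using n by linarith
    qed
    finally show False by simp
  qed
  then show ?thesis by (simp add: n_def z_def)
qed

lemma borel_measurable_operator_apply:
  fixes F :: "real \<Rightarrow> 'a::fd_chilbert \<Rightarrow> 'b::fd_chilbert"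
  assumes F: "borel_op I F" "\<And>t. t \<in> I \<Longrightarrow> F t \<in> operators UNIV UNIV"
    and f: "f \<in> borel_measurable (restrict_space borel I)"
  shows "(\<lambda>t. F t (f t)) \<in> borel_measurable (restrict_space borel I)"
proof -
  obtain E :: "'a set" where E: "finite E" "\<forall>x\<in>UNIV. (\<Sum>e\<in>E. cinner x e *\<^sub>C e) = x"
    using orthonormal_basis_exists[OF csubspace_UNIV] by blast
  have [measurable]: "(\<lambda>t. F t e) \<in> borel_measurable (restrict_space borel I)" for e
    using F(1) by (simp add: borel_op_def)
  note f [measurable]
  have "F t (f t) = (\<Sum>e\<in>E. cinner (f t) e *\<^sub>C F t e)" if t: "t \<in> I" for t
  proof -
    note Ft = operatorsD(2,3)[OF F(2)[OF t], OF UNIV_I] operators_0[OF F(2)[OF t] csubspace_UNIV]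
    have "F t (\<Sum>e\<in>E'. c e *\<^sub>C e) = (\<Sum>e\<in>E'. c e *\<^sub>C F t e)" if "finite E'" for E' c
      using that by (induction E') (auto simp: Ft)
    from this[OF E(1), of "cinner (f t)"] show ?thesis by (simp add: E(2))
  qed
  moreover have "(\<lambda>t. \<Sum>e\<in>E. cinner (f t) e *\<^sub>C F t e) \<in> borel_measurable (restrict_space borel I)"
    by measurable
  ultimately show ?thesis
    by (subst measurable_cong[where g = "\<lambda>t. \<Sum>e\<in>E. cinner (f t) e *\<^sub>C F t e"])
       (auto simp: space_restrict_space)
qed

lemma sym_sysD:
  assumes "symmetric_system S"
  shows sym_sys_less: "ereal (lend S) < rend S"
    and sym_sys_ivl: "ivl S = {t. lend S \<le> t \<and> ereal t < rend S} \<or> ivl S = {t. lend S \<le> t \<and> ereal t \<le> rend S}"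
    and sym_sys_B: "t \<in> ivl S \<Longrightarrow> Bcf S t \<in> operators UNIV UNIV"
    and sym_sys_D: "t \<in> ivl S \<Longrightarrow> Dcf S t \<in> operators UNIV UNIV"
    and sym_sys_borel: "borel_op (ivl S) (Dcf S)"
    and sym_sys_AE: "AE t in lborel. t \<in> ivl S \<longrightarrow>
          cadj UNIV UNIV (Bcf S t) = Bcf S t \<and> op_nonneg UNIV (Dcf S t)"
  using assms by (auto simp: symmetric_system_def)

lemma sym_sys_ivlD:
  assumes "symmetric_system S"
  shows ivl_lend: "lend S \<in> ivl S"
    and ivl_open: "lend S \<le> t \<Longrightarrow> ereal t < rend S \<Longrightarrow> t \<in> ivl S"
    and ivl_bounds: "t \<in> ivl S \<Longrightarrow> lend S \<le> t \<and> ereal t \<le> rend S"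
    and ivl_Icc: "t \<in> ivl S \<Longrightarrow> {lend S..t} \<subseteq> ivl S"
    and ivl_borel: "ivl S \<in> sets borel"
proof -
  note S = sym_sysD(1,2)[OF assms]
  show "lend S \<in> ivl S" "lend S \<le> t \<Longrightarrow> ereal t < rend S \<Longrightarrow> t \<in> ivl S"
    "t \<in> ivl S \<Longrightarrow> lend S \<le> t \<and> ereal t \<le> rend S"
    using S by (elim disjE; simp add: less_imp_le)+
  show "{lend S..t} \<subseteq> ivl S" if t: "t \<in> ivl S"
  proof
    fix s assume "s \<in> {lend S..t}"
    then have "lend S \<le> s" "ereal s \<le> ereal t" by auto
    then show "s \<in> ivl S"
      using S(2) t le_less_trans[of "ereal s" "ereal t" "rend S"] order_trans[of "ereal s" "ereal t" "rend S"]
      by auto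
  qed
  have "{t. lend S \<le> t \<and> ereal t < rend S} \<in> sets borel" "{t. lend S \<le> t \<and> ereal t \<le> rend S} \<in> sets borel"
    by measurable
  then show "ivl S \<in> sets borel" using S(2) by metis
qed

text \<open>A consequence of the parallelogram law, which makes the square integrable functions closed under sums.\<close>

lemma op_nonneg_add_le:
  assumes A: "A \<in> operators UNIV UNIV" and pos: "op_nonneg UNIV A"
  shows "Re (cinner (A (x + y)) (x + y)) \<le> 2 * Re (cinner (A x) x) + 2 * Re (cinner (A y) y)"
proof -
  have "0 \<le> Re (cinner (A (x - y)) (x - y))"
    by (rule op_nonnegD(1)[OF pos])
  moreover have "Re (cinner (A (x + y)) (x + y)) + Re (cinner (A (x - y)) (x - y))
      = 2 * Re (cinner (A x) x) + 2 * Re (cinner (A y) y)"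
    by (simp add: operators_add[OF A] operators_diff[OF A csubspace_UNIV] cinner_simps)
  ultimately show ?thesis by linarith
qed

lemma L2_fun_add:
  assumes S: "symmetric_system S" and f: "f \<in> L2_fun S" and g: "g \<in> L2_fun S"
  shows "(\<lambda>t. f t + g t) \<in> L2_fun S"
proof -
  let ?M = "restrict_space borel (ivl S)"
  have [measurable]: "f \<in> borel_measurable ?M" "g \<in> borel_measurable ?M"
    using f g by (auto simp: L2_fun_def)
  have meas: "(\<lambda>t. ennreal (Re (cinner (Dcf S t (h t)) (h t))) * indicator (ivl S) t) \<in> borel_measurable lborel"
    if [measurable]: "h \<in> borel_measurable ?M" for h
  proof -
    have [measurable]: "(\<lambda>t. Dcf S t (h t)) \<in> borel_measurable ?M"
      by (rule borel_measurable_operator_apply[OF sym_sys_borel[OF S] sym_sys_D[OF S] that])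
    have "(\<lambda>t. ennreal (Re (cinner (Dcf S t (h t)) (h t)))) \<in> borel_measurable ?M"
      by measurable
    then show ?thesis
      using borel_measurable_restrict_space_iff_ennreal[of "ivl S" borel] ivl_borel[OF S] by simp
  qed
  have "L2_normsq S (\<lambda>t. f t + g t)
      \<le> (\<integral>\<^sup>+ t. 2 * (ennreal (Re (cinner (Dcf S t (f t)) (f t))) * indicator (ivl S) t)
         + 2 * (ennreal (Re (cinner (Dcf S t (g t)) (g t))) * indicator (ivl S) t) \<partial>lborel)"
    unfolding L2_normsq_def
  proof (rule nn_integral_mono_AE)
    show "AE t in lborel. ennreal (Re (cinner (Dcf S t (f t + g t)) (f t + g t))) * indicator (ivl S) t
       \<le> 2 * (ennreal (Re (cinner (Dcf S t (f t)) (f t))) * indicator (ivl S) t)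
         + 2 * (ennreal (Re (cinner (Dcf S t (g t)) (g t))) * indicator (ivl S) t)"
      using sym_sys_AE[OF S]
    proof eventually_elim
      case (elim t)
      show ?case
      proof (cases "t \<in> ivl S")
        case True
        then have pos: "op_nonneg UNIV (Dcf S t)" using elim by blast
        note op_nonnegD(1)[OF pos]
        then have "2 * ennreal (Re (cinner (Dcf S t (f t)) (f t))) + 2 * ennreal (Re (cinner (Dcf S t (g t)) (g t)))
          = ennreal (2 * Re (cinner (Dcf S t (f t)) (f t)) + 2 * Re (cinner (Dcf S t (g t)) (g t)))"
          by (simp add: ennreal_mult ennreal_plus)
        then show ?thesis
          using True op_nonneg_add_le[OF sym_sys_D[OF S True] pos, of "f t" "g t"]
          by (simp add: ennreal_leI)
      qed simp
    qed
  qed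
  also have "\<dots> = 2 * L2_normsq S f + 2 * L2_normsq S g"
    unfolding L2_normsq_def using meas[of f] meas[of g]
    by (subst nn_integral_add) (auto simp: nn_integral_cmult)
  also have "\<dots> < \<infinity>"
    using f g by (auto simp: L2_fun_def ennreal_mult_less_top)
  finally show ?thesis by (simp add: L2_fun_def)
qed

lemma L2_fun_scaleC:
  assumes S: "symmetric_system S" and f: "f \<in> L2_fun S"
  shows "(\<lambda>t. c *\<^sub>C f t) \<in> L2_fun S"
proof -
  let ?M = "restrict_space borel (ivl S)"
  have [measurable]: "f \<in> borel_measurable ?M" using f by (auto simp: L2_fun_def)
  have [measurable]: "(\<lambda>t. Dcf S t (f t)) \<in> borel_measurable ?M"
    by (rule borel_measurable_operator_apply[OF sym_sys_borel[OF S] sym_sys_D[OF S]]) auto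
  have "(\<lambda>t. ennreal (Re (cinner (Dcf S t (f t)) (f t)))) \<in> borel_measurable ?M"
    by measurable
  then have meas: "(\<lambda>t. ennreal (Re (cinner (Dcf S t (f t)) (f t))) * indicator (ivl S) t) \<in> borel_measurable lborel"
    using borel_measurable_restrict_space_iff_ennreal[of "ivl S" borel] ivl_borel[OF S] by simp
  have "L2_normsq S (\<lambda>t. c *\<^sub>C f t)
      = (\<integral>\<^sup>+ t. ennreal ((norm c)\<^sup>2) * (ennreal (Re (cinner (Dcf S t (f t)) (f t))) * indicator (ivl S) t) \<partial>lborel)"
    unfolding L2_normsq_def
  proof (rule nn_integral_cong)
    fix t
    show "ennreal (Re (cinner (Dcf S t (c *\<^sub>C f t)) (c *\<^sub>C f t))) * indicator (ivl S) t
      = ennreal ((norm c)\<^sup>2) * (ennreal (Re (cinner (Dcf S t (f t)) (f t))) * indicator (ivl S) t)"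
    proof (cases "t \<in> ivl S")
      case True
      have "cinner (Dcf S t (c *\<^sub>C f t)) (c *\<^sub>C f t)
          = complex_of_real ((norm c)\<^sup>2) * cinner (Dcf S t (f t)) (f t)"
        unfolding complex_norm_square
        by (simp add: operators_scaleC[OF sym_sys_D[OF S True]] cinner_simps)
      then show ?thesis by (simp add: ennreal_mult' mult.assoc del: of_real_power)
    qed simp
  qed
  also have "\<dots> = ennreal ((norm c)\<^sup>2) * L2_normsq S f"
    unfolding L2_normsq_def using meas by (rule nn_integral_cmult)
  also have "\<dots> < \<infinity>"
    using f by (auto simp: L2_fun_def ennreal_mult_less_top)
  finally have "L2_normsq S (\<lambda>t. c *\<^sub>C f t) < \<infinity>" .
  then show ?thesis by (simp add: L2_fun_def)
qed

lemma Jop_operators: "Jop \<in> operators UNIV UNIV"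
  by (auto simp: operators_def Jop_def scaleC_prod_def scaleC_add_right scaleC_scaleC
      scaleC_minus_right mult.commute)

lemma Jop_0: "Jop 0 = 0"
  by (rule operators_0[OF Jop_operators csubspace_UNIV])

lemma cinner_Jop_right: "cinner x (Jop y) = - cinner (Jop x) y"
  by (auto simp: Jop_def cinner_prod_def cinner_simps split: prod.splits)

lemma norm_Jop: "norm (Jop x) = norm x"
proof -
  have "cinner (Jop x) (Jop x) = cinner x x"
    by (auto simp: Jop_def cinner_prod_def cinner_simps scaleC_prod_def split: prod.splits)
  then show ?thesis by (simp add: cinner_self flip: of_real_power)
qed

lemma bounded_linear_Jop: "bounded_linear Jop"
  using operatorsD(2,3)[OF Jop_operators]
  by (intro bounded_linear_intro[of _ 1]) (auto simp: norm_Jop scaleR_scaleC)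

lemma Re_cinner_Jop: "Re (cinner (Jop y) y) = 0"
  using cinner_Jop_right[of y y] cinner_commute[of y "Jop y"] by (simp add: complex_eq_iff)

definition L2_solutions :: "('h::fd_chilbert, 'k::fd_chilbert) sym_sys \<Rightarrow> complex
    \<Rightarrow> (real \<Rightarrow> ('h, 'k) HH) set" where
  "L2_solutions S \<mu> = {y \<in> L2_fun S. solves_E S \<mu> y}"

lemma L2_solutions_dom_Tmax:
  assumes S: "symmetric_system S" and y: "y \<in> L2_solutions S \<mu>"
  shows "y \<in> dom_Tmax S"
proof -
  have "solves_system S y (\<lambda>t. \<mu> *\<^sub>C y t)"
    unfolding solves_system_def
  proof
    show "y \<in> AC S" using y by (simp add: L2_solutions_def solves_E_def)
    have "AE t in lborel. t \<in> ivl S \<longrightarrow> (\<exists>y'. (y has_vector_derivative y') (at t within ivl S)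
        \<and> Jop y' - Bcf S t (y t) = \<mu> *\<^sub>C Dcf S t (y t))"
      using y by (simp add: L2_solutions_def solves_E_def)
    then show "AE t in lborel. t \<in> ivl S \<longrightarrow> (\<exists>y'. (y has_vector_derivative y') (at t within ivl S)
        \<and> Jop y' - Bcf S t (y t) = Dcf S t (\<mu> *\<^sub>C y t))"
      by eventually_elim (use operators_scaleC[OF sym_sys_D[OF S]] in auto)
  qed
  then have "(y, \<lambda>t. \<mu> *\<^sub>C y t) \<in> Tmax_fun S"
    using y L2_fun_scaleC[OF S] by (auto simp: Tmax_fun_def L2_solutions_def)
  then show ?thesis by (force simp: dom_Tmax_def)
qed

lemma L2_solutions_add:
  assumes S: "symmetric_system S" and y: "y \<in> L2_solutions S \<mu>" and z: "z \<in> L2_solutions S \<mu>"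
  shows "(\<lambda>t. y t + z t) \<in> L2_solutions S \<mu>"
proof -
  have "(\<lambda>t. y t + z t) \<in> AC S"
    using y z abs_cont_on_bound[of _ y z "\<lambda>t. y t + z t" 1]
    by (auto simp: AC_def L2_solutions_def solves_E_def add_diff_add norm_triangle_ineq)
  moreover have "AE t in lborel. t \<in> ivl S \<longrightarrow> (\<exists>y'. (y has_vector_derivative y') (at t within ivl S)
        \<and> Jop y' - Bcf S t (y t) = \<mu> *\<^sub>C Dcf S t (y t))"
     "AE t in lborel. t \<in> ivl S \<longrightarrow> (\<exists>y'. (z has_vector_derivative y') (at t within ivl S)
        \<and> Jop y' - Bcf S t (z t) = \<mu> *\<^sub>C Dcf S t (z t))"
    using y z by (auto simp: L2_solutions_def solves_E_def)
  then have "AE t in lborel. t \<in> ivl S \<longrightarrow> (\<exists>y'. ((\<lambda>t. y t + z t) has_vector_derivative y') (at t within ivl S)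
        \<and> Jop y' - Bcf S t (y t + z t) = \<mu> *\<^sub>C Dcf S t (y t + z t))"
  proof eventually_elim
    case (elim t)
    show ?case
    proof
      assume t: "t \<in> ivl S"
      then obtain y' z' where
        y': "(y has_vector_derivative y') (at t within ivl S)" "Jop y' - Bcf S t (y t) = \<mu> *\<^sub>C Dcf S t (y t)"
        and z': "(z has_vector_derivative z') (at t within ivl S)" "Jop z' - Bcf S t (z t) = \<mu> *\<^sub>C Dcf S t (z t)"
        using elim by blast
      have "Jop (y' + z') - Bcf S t (y t + z t)
          = (Jop y' - Bcf S t (y t)) + (Jop z' - Bcf S t (z t))"
        by (simp add: operators_add[OF Jop_operators] operators_add[OF sym_sys_B[OF S t]])
      also have "\<dots> = \<mu> *\<^sub>C Dcf S t (y t + z t)"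
        by (simp add: y'(2) z'(2) operators_add[OF sym_sys_D[OF S t]] scaleC_add_right)
      finally show "\<exists>y'. ((\<lambda>t. y t + z t) has_vector_derivative y') (at t within ivl S)
        \<and> Jop y' - Bcf S t (y t + z t) = \<mu> *\<^sub>C Dcf S t (y t + z t)"
        using has_vector_derivative_add[OF y'(1) z'(1)] by blast
    qed
  qed
  ultimately show ?thesis
    using y z L2_fun_add[OF S] by (auto simp: L2_solutions_def solves_E_def)
qed

lemma L2_solutions_scaleC:
  assumes S: "symmetric_system S" and y: "y \<in> L2_solutions S \<mu>"
  shows "(\<lambda>t. c *\<^sub>C y t) \<in> L2_solutions S \<mu>"
proof -
  have "(\<lambda>t. c *\<^sub>C y t) \<in> AC S"
    using y abs_cont_on_bound[of _ y y "\<lambda>t. c *\<^sub>C y t" "norm c"]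
    by (auto simp: AC_def L2_solutions_def solves_E_def norm_scaleC scaleC_diff_right[symmetric]
        mult_left_mono)
  moreover have "AE t in lborel. t \<in> ivl S \<longrightarrow> (\<exists>y'. (y has_vector_derivative y') (at t within ivl S)
        \<and> Jop y' - Bcf S t (y t) = \<mu> *\<^sub>C Dcf S t (y t))"
    using y by (auto simp: L2_solutions_def solves_E_def)
  then have "AE t in lborel. t \<in> ivl S \<longrightarrow> (\<exists>y'. ((\<lambda>t. c *\<^sub>C y t) has_vector_derivative y') (at t within ivl S)
        \<and> Jop y' - Bcf S t (c *\<^sub>C y t) = \<mu> *\<^sub>C Dcf S t (c *\<^sub>C y t))"
  proof eventually_elim
    case (elim t)
    show ?case
    proof
      assume t: "t \<in> ivl S"
      then obtain y' where
        y': "(y has_vector_derivative y') (at t within ivl S)" "Jop y' - Bcf S t (y t) = \<mu> *\<^sub>C Dcf S t (y t)"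
        using elim by blast
      have "Jop (c *\<^sub>C y') - Bcf S t (c *\<^sub>C y t) = c *\<^sub>C (Jop y' - Bcf S t (y t))"
        by (simp add: operators_scaleC[OF Jop_operators] operators_scaleC[OF sym_sys_B[OF S t]] scaleC_diff_right)
      also have "\<dots> = \<mu> *\<^sub>C Dcf S t (c *\<^sub>C y t)"
        by (simp add: y'(2) operators_scaleC[OF sym_sys_D[OF S t]] scaleC_scaleC mult.commute)
      finally show "\<exists>y'. ((\<lambda>t. c *\<^sub>C y t) has_vector_derivative y') (at t within ivl S)
        \<and> Jop y' - Bcf S t (c *\<^sub>C y t) = \<mu> *\<^sub>C Dcf S t (c *\<^sub>C y t)"
        using bounded_linear.has_vector_derivative[OF
          bounded_bilinear.bounded_linear_right[OF bounded_bilinear_scaleC] y'(1)] by blast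
    qed
  qed
  ultimately show ?thesis
    using y L2_fun_scaleC[OF S] by (auto simp: L2_solutions_def solves_E_def)
qed

lemma L2_solutions_diff:
  assumes S: "symmetric_system S" and y: "y \<in> L2_solutions S \<mu>" and z: "z \<in> L2_solutions S \<mu>"
  shows "(\<lambda>t. y t - z t) \<in> L2_solutions S \<mu>"
  using L2_solutions_add[OF S y L2_solutions_scaleC[OF S z, of "- 1"]]
  by (simp add: scaleC_neg1)

section \<open>The Lagrange identity\<close>

text \<open>
  As \<open>J\<close> is skew-adjoint, \<open>(J x, x)\<close> is the imaginary number \<open>i J_form x\<close>.
\<close>

definition J_form :: "('h::fd_chilbert, 'k::fd_chilbert) HH \<Rightarrow> real" where
  "J_form x = Im (cinner (Jop x) x)"

lemma cinner_Jop_self: "cinner (Jop x) x = \<i> * complex_of_real (J_form x)"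
  by (simp add: J_form_def complex_eq_iff Re_cinner_Jop)

lemma J_form_diff_le: "\<bar>J_form x - J_form y\<bar> \<le> (norm x + norm y) * norm (x - y)"
proof -
  have "J_form x - J_form y = Im (cinner (Jop (x - y)) x + cinner (Jop y) (x - y))"
    by (simp add: J_form_def operators_diff[OF Jop_operators csubspace_UNIV] cinner_simps)
  also have "\<bar>\<dots>\<bar> \<le> norm (cinner (Jop (x - y)) x) + norm (cinner (Jop y) (x - y))"
    by (rule order_trans[OF abs_Im_le_cmod norm_triangle_ineq])
  also have "\<dots> \<le> norm (x - y) * norm x + norm y * norm (x - y)"
    using norm_cinner_le[of "Jop (x - y)" x] norm_cinner_le[of "Jop y" "x - y"]
    by (simp add: norm_Jop)
  finally show ?thesis by (simp add: algebra_simps)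
qed

lemma abs_cont_on_J_form:
  assumes y: "abs_cont_on {a..b} y"
  shows "abs_cont_on {a..b} (\<lambda>t. J_form (y t))"
proof -
  have "compact (y ` {a..b})"
    by (intro compact_continuous_image abs_cont_on_imp_continuous_on y) simp
  then have "\<exists>M. \<forall>x\<in>y ` {a..b}. norm x \<le> M"
    unfolding bounded_iff[symmetric] by (rule compact_imp_bounded)
  then obtain M where "\<forall>x\<in>y ` {a..b}. norm x \<le> M" by (elim exE)
  then have M: "\<And>t. t \<in> {a..b} \<Longrightarrow> norm (y t) \<le> M" by blast
  show ?thesis
  proof (rule abs_cont_on_bound[OF y y, where C = M])
    fix s t assume st: "s \<in> {a..b}" "t \<in> {a..b}"
    have "norm (J_form (y t) - J_form (y s)) \<le> (norm (y t) + norm (y s)) * norm (y t - y s)"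
      unfolding real_norm_def by (rule J_form_diff_le)
    also have "\<dots> \<le> (M + M) * norm (y t - y s)"
      using M st by (intro mult_right_mono add_mono) auto
    finally show "norm (J_form (y t) - J_form (y s)) \<le> M * (norm (y t - y s) + norm (y t - y s))"
      by (simp add: algebra_simps)
  qed
qed

text \<open>
  The Lagrange identity in infinitesimal form: the selfadjoint coefficient \<open>B\<close> contributes only a real
  number to \<open>(J y', y)\<close>, so its imaginary part comes from the term with \<open>\<mu>\<close> alone.
\<close>

lemma J_form_derivative:
  assumes S: "symmetric_system S" and y: "solves_E S \<mu> y"
  obtains N where "negligible N"
    "\<And>t. t \<in> ivl S - N \<Longrightarrow> ((\<lambda>t. J_form (y t)) has_vector_derivative
        2 * Im \<mu> * Re (cinner (Dcf S t (y t)) (y t))) (at t within ivl S)"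
    "\<And>t. t \<in> ivl S - N \<Longrightarrow> op_nonneg UNIV (Dcf S t)"
proof -
  have "AE t in lborel. t \<in> ivl S \<longrightarrow> op_nonneg UNIV (Dcf S t) \<and>
      ((\<lambda>t. J_form (y t)) has_vector_derivative
        2 * Im \<mu> * Re (cinner (Dcf S t (y t)) (y t))) (at t within ivl S)"
    (is "AE t in lborel. ?P t")
    using conjunct2[OF y[unfolded solves_E_def]] sym_sys_AE[OF S]
  proof eventually_elim
    case (elim t)
    show ?case
    proof
      assume t: "t \<in> ivl S"
      obtain y' where y': "(y has_vector_derivative y') (at t within ivl S)"
        "Jop y' - Bcf S t (y t) = \<mu> *\<^sub>C Dcf S t (y t)"
        using elim(1) t by blast
      have B: "cadj UNIV UNIV (Bcf S t) = Bcf S t" and D: "op_nonneg UNIV (Dcf S t)"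
        using elim(2) t by auto
      have "cinner (y t) (Bcf S t (y t)) = cinner (Bcf S t (y t)) (y t)"
        using cadj_cinner[OF csubspace_UNIV sym_sys_B[OF S t], of "y t" UNIV "y t"] by (simp add: B)
      then have B0: "Im (cinner (Bcf S t (y t)) (y t)) = 0"
        using cinner_commute[of "y t" "Bcf S t (y t)"] by (simp add: complex_eq_iff)
      have "((\<lambda>t. cinner (Jop (y t)) (y t)) has_vector_derivative
          (cinner (Jop (y t)) y' + cinner (Jop y') (y t))) (at t within ivl S)"
        by (intro bounded_bilinear.has_vector_derivative[OF bounded_bilinear_cinner]
            bounded_linear.has_vector_derivative[OF bounded_linear_Jop] y'(1))
      then have "((\<lambda>t. J_form (y t)) has_vector_derivative
          Im (cinner (Jop (y t)) y' + cinner (Jop y') (y t))) (at t within ivl S)"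
        unfolding J_form_def by (rule bounded_linear.has_vector_derivative[OF bounded_linear_Im])
      moreover have "Im (cinner (Jop (y t)) y' + cinner (Jop y') (y t)) = 2 * Im (cinner (Jop y') (y t))"
        using cinner_Jop_right[of "y t" y'] cinner_commute[of "y t" "Jop y'"] by (simp add: complex_eq_iff)
      moreover have "Jop y' = Bcf S t (y t) + \<mu> *\<^sub>C Dcf S t (y t)"
        using y'(2) by (simp add: algebra_simps)
      ultimately show "op_nonneg UNIV (Dcf S t) \<and> ((\<lambda>t. J_form (y t)) has_vector_derivative
          2 * Im \<mu> * Re (cinner (Dcf S t (y t)) (y t))) (at t within ivl S)"
        using D B0 op_nonnegD(2)[OF D, of "y t"] by (simp add: cinner_simps mult.assoc)
    qed
  qed
  then have "AE t in lebesgue. ?P t" by (rule AE_completion)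
  then obtain N where "negligible N" "{t. \<not> ?P t} \<subseteq> N"
    by (auto simp: eventually_ae_filter_negligible)
  then show ?thesis by (intro that[of N]) auto
qed

lemma J_form_increment:
  assumes S: "symmetric_system S" and y: "solves_E S \<mu> y" and \<mu>: "Im \<mu> \<noteq> 0"
    and st: "lend S \<le> s" "s \<le> t" "t \<in> ivl S"
  obtains I where "J_form (y t) - J_form (y s) = 2 * Im \<mu> * I" "0 \<le> I" "ennreal I \<le> L2_normsq S y"
proof -
  obtain N where N: "negligible N"
    "\<And>t. t \<in> ivl S - N \<Longrightarrow> ((\<lambda>t. J_form (y t)) has_vector_derivative
        2 * Im \<mu> * Re (cinner (Dcf S t (y t)) (y t))) (at t within ivl S)"
    "\<And>t. t \<in> ivl S - N \<Longrightarrow> op_nonneg UNIV (Dcf S t)"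
    by (rule J_form_derivative[OF S y]) (rule that)
  \<comment> \<open>The density is cut off at zero to be nonnegative at every point, exceptional ones included.\<close>
  define w where "w = (\<lambda>t. max 0 (Re (cinner (Dcf S t (y t)) (y t))))"
  have sub: "{s..t} \<subseteq> ivl S" using ivl_Icc[OF S st(3)] st(1) by auto
  have "abs_cont_on {lend S..t} y" using y st(3) by (auto simp: solves_E_def AC_def)
  then have "abs_cont_on {s..t} (\<lambda>t. J_form (y t))"
    using st(1) by (intro abs_cont_on_J_form) (rule abs_cont_on_subset, auto)
  then have int: "((\<lambda>r. 2 * Im \<mu> * w r) has_integral J_form (y t) - J_form (y s)) {s..t}"
  proof (rule abs_cont_fundamental_theorem[OF st(2) _ N(1)])
    fix r assume r: "r \<in> {s..t} - N"
    then have "r \<in> ivl S - N" using sub by auto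
    from has_vector_derivative_within_subset[OF N(2)[OF this] sub] op_nonnegD(1)[OF N(3)[OF this]]
    show "((\<lambda>t. J_form (y t)) has_vector_derivative 2 * Im \<mu> * w r) (at r within {s..t})"
      by (simp add: w_def max_absorb2)
  qed
  define I where "I = (J_form (y t) - J_form (y s)) / (2 * Im \<mu>)"
  have w: "(w has_integral I) {s..t}"
    using has_integral_mult_right[OF int, of "1 / (2 * Im \<mu>)"] \<mu> by (simp add: I_def)
  have "ennreal I = (\<integral>\<^sup>+ r. ennreal (indicator {s..t} r * w r) \<partial>lborel)"
    by (rule nn_integral_has_integral_lebesgue[OF _ w, symmetric]) (simp add: w_def)
  also have "\<dots> \<le> L2_normsq S y"
    unfolding L2_normsq_def
    using sub by (intro nn_integral_mono) (auto simp: indicator_def w_def max_def ennreal_neg)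
  finally show ?thesis
    using \<mu> has_integral_nonneg[OF w] by (intro that[of I]) (auto simp: I_def w_def)
qed

lemma eventually_to_rend:
  assumes S: "symmetric_system S" and c: "lend S \<le> c" "ereal c < rend S"
    and P: "\<And>t. c < t \<Longrightarrow> ereal t < rend S \<Longrightarrow> P t"
  shows "eventually P (to_rend S)"
proof (cases "rend S = \<infinity>")
  case True
  then show ?thesis
    using P unfolding to_rend_def by (auto intro!: eventually_mono[OF eventually_gt_at_top[of c]])
next
  case False
  then obtain r where r: "rend S = ereal r" using c(2) by (cases "rend S") auto
  then show ?thesis
    using P c(2) unfolding to_rend_def by (auto simp: eventually_at_left_field)
qed

lemma to_rend_neq_bot: "to_rend S \<noteq> bot"
  by (simp add: to_rend_def)

text \<open>
  Along a solution, \<open>Im \<mu>\<close> times \<open>J_form\<close> is increasing and, by square integrability, bounded. Hence the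
  bracket at the right end is a genuine limit, and it dominates the values inside the interval.
\<close>

lemma bracket_b_solution:
  assumes S: "symmetric_system S" and \<mu>: "Im \<mu> \<noteq> 0" and y: "y \<in> L2_solutions S \<mu>"
  obtains Q where "bracket_b S y y = \<i> * complex_of_real Q"
    "\<And>t. lend S \<le> t \<Longrightarrow> ereal t < rend S \<Longrightarrow> Im \<mu> * J_form (y t) \<le> Im \<mu> * Q"
proof -
  have yE: "solves_E S \<mu> y" and fin: "L2_normsq S y < \<infinity>" using y by (auto simp: L2_solutions_def L2_fun_def)
  note a = sym_sys_less[OF S]
  define X where "X = {t. lend S \<le> t \<and> ereal t < rend S}"
  define \<phi> where "\<phi> = (\<lambda>t. Im \<mu> * J_form (y t))"
  have mono: "\<phi> s \<le> \<phi> t" if st: "s \<in> X" "t \<in> X" "s \<le> t" for s t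
  proof -
    have "lend S \<le> s" "t \<in> ivl S" using st ivl_open[OF S] by (auto simp: X_def)
    then obtain I where "J_form (y t) - J_form (y s) = 2 * Im \<mu> * I" "0 \<le> I"
      using J_form_increment[OF S yE \<mu>, of s t] st(3) by blast
    then have "\<phi> t - \<phi> s = 2 * (Im \<mu>)\<^sup>2 * I"
      by (simp add: \<phi>_def right_diff_distrib[symmetric] power2_eq_square)
    moreover have "0 \<le> 2 * (Im \<mu>)\<^sup>2 * I" using \<open>0 \<le> I\<close> by simp
    ultimately show ?thesis by linarith
  qed
  have "\<phi> t \<le> \<phi> (lend S) + 2 * (Im \<mu>)\<^sup>2 * enn2real (L2_normsq S y)" if t: "t \<in> X" for t
  proof -
    have "lend S \<le> t" "t \<in> ivl S" using t ivl_open[OF S] by (auto simp: X_def)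
    then obtain I where I: "J_form (y t) - J_form (y (lend S)) = 2 * Im \<mu> * I" "0 \<le> I" "ennreal I \<le> L2_normsq S y"
      using J_form_increment[OF S yE \<mu>, of "lend S" t] by blast
    have "I \<le> enn2real (L2_normsq S y)"
      using enn2real_mono[OF I(3)] fin I(2) by simp
    then have "2 * (Im \<mu>)\<^sup>2 * I \<le> 2 * (Im \<mu>)\<^sup>2 * enn2real (L2_normsq S y)"
      by (intro mult_left_mono) auto
    moreover have "\<phi> t - \<phi> (lend S) = 2 * (Im \<mu>)\<^sup>2 * I"
      using I(1) by (simp add: \<phi>_def right_diff_distrib[symmetric] power2_eq_square)
    ultimately show ?thesis by linarith
  qed
  then have bdd: "bdd_above (\<phi> ` X)" by (auto intro!: bdd_aboveI)
  have ne: "lend S \<in> X" using a by (simp add: X_def)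
  define L where "L = (SUP t\<in>X. \<phi> t)"
  have le: "\<phi> t \<le> L" if "t \<in> X" for t unfolding L_def by (rule cSUP_upper[OF that bdd])
  have lim: "(\<phi> \<longlongrightarrow> L) (to_rend S)"
  proof (rule order_tendstoI)
    fix l assume "l < L"
    then obtain c where c: "c \<in> X" "l < \<phi> c"
      using less_cSUP_iff[of X \<phi> l] bdd ne unfolding L_def by auto
    show "eventually (\<lambda>t. l < \<phi> t) (to_rend S)"
    proof (rule eventually_to_rend[OF S, of c])
      fix t assume "c < t" "ereal t < rend S"
      then show "l < \<phi> t" using mono[of c t] c by (force simp: X_def)
    qed (use c in \<open>auto simp: X_def\<close>)
  next
    fix u assume "L < u"
    show "eventually (\<lambda>t. \<phi> t < u) (to_rend S)"
    proof (rule eventually_to_rend[OF S order_refl a])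
      fix t assume "lend S < t" "ereal t < rend S"
      then have "\<phi> t \<le> L" by (intro le) (simp add: X_def)
      then show "\<phi> t < u" using \<open>L < u\<close> by simp
    qed
  qed
  have "((\<lambda>t. \<phi> t / Im \<mu>) \<longlongrightarrow> L / Im \<mu>) (to_rend S)"
    by (intro tendsto_divide lim tendsto_const \<mu>)
  then have "((\<lambda>t. \<i> * complex_of_real (\<phi> t / Im \<mu>)) \<longlongrightarrow> \<i> * complex_of_real (L / Im \<mu>)) (to_rend S)"
    by (intro tendsto_mult_left tendsto_of_real)
  then have "bracket_b S y y = \<i> * complex_of_real (L / Im \<mu>)"
    unfolding bracket_b_def using \<mu>
    by (intro tendsto_Lim[OF to_rend_neq_bot]) (simp add: cinner_Jop_self \<phi>_def)
  then show ?thesis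
    using \<mu> le by (intro that[of "L / Im \<mu>"]) (auto simp: \<phi>_def X_def)
qed

text \<open>
  If the limit at the right end does not exceed the value at the left end, the monotone function
  \<open>Im \<mu> J_form\<close> is constant. Its derivative then vanishes, so \<open>\<Delta> y = 0\<close> almost everywhere, and definiteness applies.
\<close>

lemma solution_vanishes:
  assumes S: "symmetric_system S" and def: "definite_system S" and \<mu>: "Im \<mu> \<noteq> 0"
    and y: "y \<in> L2_solutions S \<mu>" and Q: "bracket_b S y y = \<i> * complex_of_real Q"
    and le: "Im \<mu> * Q \<le> Im \<mu> * J_form (y (lend S))"
  shows "\<forall>t\<in>ivl S. y t = 0"
proof -
  have yE: "solves_E S \<mu> y" using y by (auto simp: L2_solutions_def)
  define X where "X = {t. lend S < t \<and> ereal t < rend S}"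
  have const: "J_form (y t) = J_form (y (lend S))" if "t \<in> X" for t
  proof -
    obtain Q' where Q': "bracket_b S y y = \<i> * complex_of_real Q'"
      "\<And>t. lend S \<le> t \<Longrightarrow> ereal t < rend S \<Longrightarrow> Im \<mu> * J_form (y t) \<le> Im \<mu> * Q'"
      using bracket_b_solution[OF S \<mu> y] by blast
    have "Q' = Q" using Q Q'(1) by simp
    have t: "lend S \<le> t" "ereal t < rend S" using that by (auto simp: X_def)
    obtain I where I: "J_form (y t) - J_form (y (lend S)) = 2 * Im \<mu> * I" "0 \<le> I"
      using J_form_increment[OF S yE \<mu> order_refl t(1) ivl_open[OF S t]] by blast
    have "Im \<mu> * (J_form (y t) - J_form (y (lend S))) \<le> 0"
      using Q'(2)[OF t] le by (simp add: \<open>Q' = Q\<close> right_diff_distrib)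
    then have "(Im \<mu>)\<^sup>2 * I \<le> 0" by (simp add: I(1) power2_eq_square mult_ac)
    then have "I = 0" using I(2) \<mu> by (simp add: mult_le_0_iff)
    then show ?thesis using I(1) by simp
  qed
  have "open X"
  proof -
    have "X = {lend S<..} \<inter> {t. ereal t < rend S}" by (auto simp: X_def)
    moreover have "open {t. ereal t < rend S}"
      by (intro open_Collect_less continuous_intros)
    ultimately show ?thesis by auto
  qed
  obtain N where N: "negligible N"
    "\<And>t. t \<in> ivl S - N \<Longrightarrow> ((\<lambda>t. J_form (y t)) has_vector_derivative
        2 * Im \<mu> * Re (cinner (Dcf S t (y t)) (y t))) (at t within ivl S)"
    "\<And>t. t \<in> ivl S - N \<Longrightarrow> op_nonneg UNIV (Dcf S t)"
    by (rule J_form_derivative[OF S yE]) (rule that)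
  have zero: "Dcf S t (y t) = 0" if t: "t \<in> X" "t \<notin> N" for t
  proof -
    have ti: "t \<in> ivl S" and sub: "X \<subseteq> ivl S" using t(1) ivl_open[OF S] by (auto simp: X_def)
    have at: "at t within X = at t" using \<open>open X\<close> t(1) by (rule at_within_open[rotated])
    have "((\<lambda>t. J_form (y t)) has_vector_derivative 2 * Im \<mu> * Re (cinner (Dcf S t (y t)) (y t))) (at t within X)"
      using ti t(2) by (intro has_vector_derivative_within_subset[OF N(2) sub]) auto
    moreover have "((\<lambda>t. J_form (y t)) has_vector_derivative 0) (at t within X)"
      by (rule has_vector_derivative_transform[OF t(1) _ has_vector_derivative_const])
         (rule const)
    ultimately have "2 * Im \<mu> * Re (cinner (Dcf S t (y t)) (y t)) = 0"
      unfolding at by (rule vector_derivative_unique_at)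
    then show ?thesis
      using \<mu> ti t(2) by (intro operator_nonneg_eq_0[OF sym_sys_D[OF S ti] N(3)]) auto
  qed
  have "{t. \<not> (t \<in> ivl S \<longrightarrow> Dcf S t (y t) = 0)} \<subseteq> N \<union> {lend S, real_of_ereal (rend S)}"
    using zero ivl_bounds[OF S]
    by (auto simp: X_def) (metis ereal_less_eq(3) less_eq_real_def not_less order_le_less real_of_ereal.simps(1))+
  moreover have "negligible (N \<union> {lend S, real_of_ereal (rend S)})"
    using N(1) by auto
  ultimately have "AE t in lebesgue. t \<in> ivl S \<longrightarrow> Dcf S t (y t) = 0"
    unfolding eventually_ae_filter_negligible by blast
  then have "AE t in lborel. t \<in> ivl S \<longrightarrow> Dcf S t (y t) = 0"
    by (simp add: AE_completion_iff)
  then show ?thesis using def yE by (auto simp: definite_system_def)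
qed

section \<open>Boundary values of solutions\<close>

lemma boundary_map_bD:
  assumes "boundary_map_b S G"
  shows bmap_Hb: "csubspace (Hb G)"
    and bmap_add: "y \<in> dom_Tmax S \<Longrightarrow> z \<in> dom_Tmax S \<Longrightarrow>
        Gamma0b G (\<lambda>t. y t + z t) = Gamma0b G y + Gamma0b G z
      \<and> Gammahb G (\<lambda>t. y t + z t) = Gammahb G y + Gammahb G z
      \<and> Gamma1b G (\<lambda>t. y t + z t) = Gamma1b G y + Gamma1b G z"
    and bmap_scaleC: "y \<in> dom_Tmax S \<Longrightarrow>
        Gamma0b G (\<lambda>t. c *\<^sub>C y t) = c *\<^sub>C Gamma0b G y
      \<and> Gammahb G (\<lambda>t. c *\<^sub>C y t) = c *\<^sub>C Gammahb G y
      \<and> Gamma1b G (\<lambda>t. c *\<^sub>C y t) = c *\<^sub>C Gamma1b G y"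
    and bmap_mem: "y \<in> dom_Tmax S \<Longrightarrow> Gamma1b G y \<in> Hb G"
    and bmap_surj: "h1 \<in> Hb G \<Longrightarrow>
        \<exists>z\<in>dom_Tmax S. Gamma0b G z = h0 \<and> Gammahb G z = k \<and> Gamma1b G z = h1"
    and bmap_bracket: "y \<in> dom_Tmax S \<Longrightarrow> z \<in> dom_Tmax S \<Longrightarrow>
      bracket_b S y z =
        cinner (Gamma0b G y) (Gamma1b G z) - cinner (Gamma1b G y) (Gamma0b G z)
        + \<i> * cinner (cproj (orth (Hb G)) (Gamma0b G y)) (cproj (orth (Hb G)) (Gamma0b G z))
        + \<i> * cinner (Gammahb G y) (Gammahb G z)"
proof -
  note b = assms[unfolded boundary_map_b_def Let_def]
  show "csubspace (Hb G)" using b by blast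
  show "y \<in> dom_Tmax S \<Longrightarrow> z \<in> dom_Tmax S \<Longrightarrow>
        Gamma0b G (\<lambda>t. y t + z t) = Gamma0b G y + Gamma0b G z
      \<and> Gammahb G (\<lambda>t. y t + z t) = Gammahb G y + Gammahb G z
      \<and> Gamma1b G (\<lambda>t. y t + z t) = Gamma1b G y + Gamma1b G z"
    using b by simp
  show "y \<in> dom_Tmax S \<Longrightarrow>
        Gamma0b G (\<lambda>t. c *\<^sub>C y t) = c *\<^sub>C Gamma0b G y
      \<and> Gammahb G (\<lambda>t. c *\<^sub>C y t) = c *\<^sub>C Gammahb G y
      \<and> Gamma1b G (\<lambda>t. c *\<^sub>C y t) = c *\<^sub>C Gamma1b G y"
    using b by (simp add: scaleC_prod_def)
  have img: "(\<lambda>y. (Gamma0b G y, Gammahb G y, Gamma1b G y)) ` dom_Tmax S = UNIV \<times> UNIV \<times> Hb G"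
    using b by blast
  show "y \<in> dom_Tmax S \<Longrightarrow> Gamma1b G y \<in> Hb G" using img by blast
  show "\<exists>z\<in>dom_Tmax S. Gamma0b G z = h0 \<and> Gammahb G z = k \<and> Gamma1b G z = h1" if "h1 \<in> Hb G"
  proof -
    have "(h0, k, h1) \<in> (\<lambda>y. (Gamma0b G y, Gammahb G y, Gamma1b G y)) ` dom_Tmax S"
      unfolding img using that by simp
    then show ?thesis by auto
  qed
  show "y \<in> dom_Tmax S \<Longrightarrow> z \<in> dom_Tmax S \<Longrightarrow>
      bracket_b S y z =
        cinner (Gamma0b G y) (Gamma1b G z) - cinner (Gamma1b G y) (Gamma0b G z)
        + \<i> * cinner (cproj (orth (Hb G)) (Gamma0b G y)) (cproj (orth (Hb G)) (Gamma0b G z))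
        + \<i> * cinner (Gammahb G y) (Gammahb G z)"
    using b by blast
qed

text \<open>
  The boundary map acts on functions on the whole real line, but it cannot see their values outside the
  interval: a function that vanishes on the interval has zero bracket with all of the domain, and by surjectivity the
  boundary form that represents the bracket is nondegenerate.
\<close>

lemma bmap_eq_0:
  assumes S: "symmetric_system S" and G: "boundary_map_b S G"
    and y: "y \<in> dom_Tmax S" and 0: "\<And>t. t \<in> ivl S \<Longrightarrow> y t = 0"
  shows "Gamma0b G y = 0 \<and> Gammahb G y = 0 \<and> Gamma1b G y = 0"
proof -
  note K = bmap_Hb[OF G]
  define P where "P = cproj (orth (Hb G))"
  have PO: "P \<in> operators UNIV (orth (Hb G))"
    unfolding P_def by (rule cproj_operators[OF csubspace_orth])
  have P0: "P 0 = 0" by (rule operators_0[OF PO csubspace_UNIV])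
  have br0: "bracket_b S y z = 0" for z
    unfolding bracket_b_def
  proof (rule tendsto_Lim[OF to_rend_neq_bot tendsto_eventually])
    show "\<forall>\<^sub>F t in to_rend S. cinner (Jop (y t)) (z t) = 0"
      using 0 ivl_open[OF S]
      by (intro eventually_to_rend[OF S order_refl sym_sys_less[OF S]]) (simp add: Jop_0)
  qed
  have br: "cinner (Gamma0b G y) h1 - cinner (Gamma1b G y) h0 + \<i> * cinner (P (Gamma0b G y)) (P h0)
      + \<i> * cinner (Gammahb G y) k = 0" if h1: "h1 \<in> Hb G" for h0 k h1
  proof -
    obtain z where z: "z \<in> dom_Tmax S" "Gamma0b G z = h0" "Gammahb G z = k" "Gamma1b G z = h1"
      using bmap_surj[OF G h1] by blast
    show ?thesis using bmap_bracket[OF G y z(1)] br0[of z] by (simp add: z P_def)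
  qed
  have K0: "0 \<in> Hb G" by (rule csubspace_0[OF K])
  have h: "Gammahb G y = 0" using br[OF K0, of 0 "Gammahb G y"] by (simp add: P0)
  have 1: "Gamma1b G y = 0"
  proof -
    have "P (Gamma1b G y) = 0"
      using cproj_orth_eq[OF K] cproj_id[OF K bmap_mem[OF G y]] by (simp add: P_def)
    then show ?thesis using br[OF K0, of "Gamma1b G y" 0] by simp
  qed
  have PP: "P (P x) = P x" for x
    unfolding P_def by (intro cproj_id csubspace_orth cproj_mem)
  have "P (Gamma0b G y) = 0" using br[OF K0, of "P (Gamma0b G y)" 0] by (simp add: 1 PP)
  moreover have "cproj (Hb G) (Gamma0b G y) = 0"
    using br[OF cproj_mem[OF K, of "Gamma0b G y"], of 0 0] cinner_cproj_left[OF K cproj_mem[OF K]]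
    by (simp add: P0) (metis cinner_self_eq_0)
  ultimately have "Gamma0b G y = 0" using cproj_orth_eq[OF K, of "Gamma0b G y"] by (simp add: P_def)
  then show ?thesis using h 1 by blast
qed

lemma bmap_diff:
  assumes S: "symmetric_system S" and G: "boundary_map_b S G"
    and y: "y \<in> L2_solutions S \<mu>" and z: "z \<in> L2_solutions S \<mu>"
  shows "Gamma0b G (\<lambda>t. y t - z t) = Gamma0b G y - Gamma0b G z"
    and "Gammahb G (\<lambda>t. y t - z t) = Gammahb G y - Gammahb G z"
    and "Gamma1b G (\<lambda>t. y t - z t) = Gamma1b G y - Gamma1b G z"
proof -
  note dom = L2_solutions_dom_Tmax[OF S]
  show "Gamma0b G (\<lambda>t. y t - z t) = Gamma0b G y - Gamma0b G z"
    "Gammahb G (\<lambda>t. y t - z t) = Gammahb G y - Gammahb G z"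
    "Gamma1b G (\<lambda>t. y t - z t) = Gamma1b G y - Gamma1b G z"
    using bmap_add[OF G dom[OF y] dom[OF L2_solutions_scaleC[OF S z, of "- 1"]]]
      bmap_scaleC[OF G dom[OF z], of "- 1"]
    by (auto simp: scaleC_neg1)
qed

lemma bmap_cong:
  assumes S: "symmetric_system S" and G: "boundary_map_b S G"
    and y: "y \<in> L2_solutions S \<mu>" and z: "z \<in> L2_solutions S \<mu>"
    and eq: "\<And>t. t \<in> ivl S \<Longrightarrow> y t = z t"
  shows "Gamma1b G y = Gamma1b G z"
  using bmap_eq_0[OF S G L2_solutions_dom_Tmax[OF S L2_solutions_diff[OF S y z]]] eq
    bmap_diff(3)[OF S G y z] by simp

lemma L2_op_solutionD:
  assumes "L2_op_solution S \<mu> Y"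
  shows "t \<in> ivl S \<Longrightarrow> Y t \<in> operators UNIV UNIV" and "(\<lambda>t. Y t h) \<in> L2_solutions S \<mu>"
  using assms by (auto simp: L2_op_solution_def L2_solutions_def)

text \<open>
  An operator solution is linear in \<open>h\<close> only at points of the interval; elsewhere the functions
  \<open>Y t (h + h')\<close> and \<open>Y t h + Y t h'\<close> may differ without effect on the boundary values.
\<close>

lemma Gamma1b_operators:
  assumes S: "symmetric_system S" and G: "boundary_map_b S G" and Y: "L2_op_solution S \<mu> Y"
  shows "(\<lambda>h. Gamma1b G (\<lambda>t. Y t h)) \<in> operators UNIV (Hb G)"
proof -
  note sol = L2_op_solutionD(2)[OF Y]
  note dom = L2_solutions_dom_Tmax[OF S sol]
  have "Gamma1b G (\<lambda>t. Y t (h + h')) = Gamma1b G (\<lambda>t. Y t h) + Gamma1b G (\<lambda>t. Y t h')" for h h'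
    using bmap_cong[OF S G sol[of "h + h'"] L2_solutions_add[OF S sol[of h] sol[of h']]]
      operators_add[OF L2_op_solutionD(1)[OF Y]] bmap_add[OF G dom[of h] dom[of h']] by simp
  moreover have "Gamma1b G (\<lambda>t. Y t (c *\<^sub>C h)) = c *\<^sub>C Gamma1b G (\<lambda>t. Y t h)" for c h
    using bmap_cong[OF S G sol[of "c *\<^sub>C h"] L2_solutions_scaleC[OF S sol[of h]]]
      operators_scaleC[OF L2_op_solutionD(1)[OF Y]] bmap_scaleC[OF G dom[of h]] by simp
  ultimately show ?thesis using bmap_mem[OF G dom] by (auto simp: operators_def)
qed

section \<open>Uniqueness\<close>

(* Elements of H \<oplus> H_hat stay single variables, so that facts quantified over them match. *)
declare split_paired_All [simp del]

lemma boundary_operators_aD: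
  assumes "boundary_operators_a U V"
  shows "V \<in> operators UNIV UNIV" and "J_form (V x) = J_form x"
proof -
  show V: "V \<in> operators UNIV UNIV" using assms unfolding boundary_operators_a_def by blast
  have "cadj UNIV UNIV V (Jop (V x)) = Jop x" using assms unfolding boundary_operators_a_def by blast
  then have "cinner (V x) (Jop (V x)) = cinner x (Jop x)"
    using cadj_cinner[OF csubspace_UNIV V, of x UNIV "Jop (V x)"] by simp
  then show "J_form (V x) = J_form x" by (simp add: J_form_def cinner_Jop_right)
qed

text \<open>
  With these boundary conditions the terms in \<open>Gammaha\<close> and \<open>Gammahb\<close> of the forms at the two ends cancel, and the
  sign condition on the rest says that the form at the right end does not exceed the one at the left end.
\<close>

lemma homogeneous_problem:
  assumes S: "symmetric_system S" and def: "definite_system S" and V: "boundary_operators_a U V"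
    and G: "boundary_map_b S G" and \<mu>: "Im \<mu> \<noteq> 0" and y: "y \<in> L2_solutions S \<mu>"
    and a: "Gamma1a S V y = 0" and ab: "Gammaha S V y = Gammahb G y"
    and b: "Im \<mu> * (2 * Im (cinner (Gamma0b G y) (Gamma1b G y))
      + (norm (cproj (orth (Hb G)) (Gamma0b G y)))\<^sup>2) \<le> 0"
  shows "\<forall>t\<in>ivl S. y t = 0"
proof -
  note dom = L2_solutions_dom_Tmax[OF S y]
  define R where "R = 2 * Im (cinner (Gamma0b G y) (Gamma1b G y))
      + (norm (cproj (orth (Hb G)) (Gamma0b G y)))\<^sup>2"
  have br: "bracket_b S y y = \<i> * complex_of_real (R + (norm (Gammahb G y))\<^sup>2)"
    using cinner_commute[of "Gamma1b G y" "Gamma0b G y"]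
    by (simp add: bmap_bracket[OF G dom dom] R_def cinner_self complex_eq_iff)
  have "J_form (y (lend S)) = (norm (Gammahb G y))\<^sup>2"
  proof -
    have "V (y (lend S)) = (Gamma0a S V y, Gammahb G y, 0)"
      using a by (simp add: Gamma0a_def Gamma1a_def Gammaha_def ab[symmetric] prod_eq_iff)
    then have "J_form (y (lend S)) = J_form (Gamma0a S V y, Gammahb G y, 0)"
      using boundary_operators_aD(2)[OF V, of "y (lend S)"] by simp
    then show ?thesis by (simp add: J_form_def Jop_def cinner_prod_def cinner_scaleC_left cinner_self)
  qed
  then show ?thesis
    using b by (intro solution_vanishes[OF S def \<mu> y br]) (simp add: R_def[symmetric] distrib_left)
qed

text \<open>
  Two operator solutions with the same boundary data differ by solutions of the homogeneous problem. If that has only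
  the trivial solution, the description operator in \<open>m_fun\<close> has a unique candidate.
\<close>

lemma m_fun_eqI:
  assumes S: "symmetric_system S" and V: "boundary_operators_a U V"
    and G: "boundary_map_b S G" and \<tau>: "boundary_param (Hb G) \<tau>"
    and Y: "is_v_tau S V G \<tau> \<mu> Y"
    and uniq: "\<And>y. y \<in> L2_solutions S \<mu> \<Longrightarrow> Gamma1a S V y = 0 \<Longrightarrow> Gammaha S V y = Gammahb G y
      \<Longrightarrow> (Im \<mu> > 0 \<Longrightarrow> C0 \<tau> \<mu> (Gamma0b G y) + C1 \<tau> \<mu> (Gamma1b G y) = 0)
      \<Longrightarrow> (Im \<mu> < 0 \<Longrightarrow> D0 \<tau> \<mu> (Gamma0b G y) + D1 \<tau> \<mu> (Gamma1b G y) = 0)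
      \<Longrightarrow> \<forall>t\<in>ivl S. y t = 0"
  shows "m_fun S V G \<tau> \<mu> = m_of_solution S V Y"
proof -
  have "m_of_solution S V Z = m_of_solution S V Y" if Z: "is_v_tau S V G \<tau> \<mu> Z" for Z
  proof
    fix h
    let ?y = "\<lambda>t. Y t h" and ?z = "\<lambda>t. Z t h" and ?d = "\<lambda>t. Y t h - Z t h"
    have sol: "?y \<in> L2_solutions S \<mu>" "?z \<in> L2_solutions S \<mu>"
      using Y Z L2_op_solutionD(2) by (auto simp: is_v_tau_def)
    note d = bmap_diff[OF S G sol]
    note K = bmap_mem[OF G L2_solutions_dom_Tmax[OF S sol(1)]] bmap_mem[OF G L2_solutions_dom_Tmax[OF S sol(2)]]
    note Kd = csubspace_diff[OF bmap_Hb[OF G]]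
    have Vd: "V (Y (lend S) h - Z (lend S) h) = V (Y (lend S) h) - V (Z (lend S) h)"
      by (rule operators_diff[OF boundary_operators_aD(1)[OF V] csubspace_UNIV]) auto
    have "\<forall>t\<in>ivl S. ?d t = 0"
    proof (rule uniq)
      show "?d \<in> L2_solutions S \<mu>" by (rule L2_solutions_diff[OF S sol])
      show "Gamma1a S V ?d = 0"
        using Y Z by (auto simp: is_v_tau_def normalized_at_a_def Gamma1a_def Vd)
      have "\<i> *\<^sub>C ((Gammaha S V ?y - Gammahb G ?y) - (Gammaha S V ?z - Gammahb G ?z)) = 0"
        using Y Z by (auto simp: is_v_tau_def normalized_at_a_def scaleC_diff_right)
      from arg_cong[OF this, of norm]
      have "(Gammaha S V ?y - Gammahb G ?y) - (Gammaha S V ?z - Gammahb G ?z) = 0"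
        by (simp add: norm_scaleC)
      then show "Gammaha S V ?d = Gammahb G ?d"
        by (simp add: Gammaha_def Vd d algebra_simps)
      show "C0 \<tau> \<mu> (Gamma0b G ?d) + C1 \<tau> \<mu> (Gamma1b G ?d) = 0" if "Im \<mu> > 0"
      proof -
        have "C0 \<tau> \<mu> \<in> operators UNIV UNIV" "C1 \<tau> \<mu> \<in> operators (Hb G) UNIV"
          using \<tau> that by (auto simp: boundary_param_def)
        then have "C0 \<tau> \<mu> (Gamma0b G ?d) + C1 \<tau> \<mu> (Gamma1b G ?d)
            = (C0 \<tau> \<mu> (Gamma0b G ?y) + C1 \<tau> \<mu> (Gamma1b G ?y))
            - (C0 \<tau> \<mu> (Gamma0b G ?z) + C1 \<tau> \<mu> (Gamma1b G ?z))"
          using K by (simp add: d operators_diff[OF _ csubspace_UNIV] operators_diff[OF _ bmap_Hb[OF G]])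
        also have "\<dots> = 0" using Y Z that by (simp add: is_v_tau_def)
        finally show ?thesis .
      qed
      show "D0 \<tau> \<mu> (Gamma0b G ?d) + D1 \<tau> \<mu> (Gamma1b G ?d) = 0" if "Im \<mu> < 0"
      proof -
        have "D0 \<tau> \<mu> \<in> operators UNIV (Hb G)" "D1 \<tau> \<mu> \<in> operators (Hb G) (Hb G)"
          using \<tau> that by (auto simp: boundary_param_def)
        then have "D0 \<tau> \<mu> (Gamma0b G ?d) + D1 \<tau> \<mu> (Gamma1b G ?d)
            = (D0 \<tau> \<mu> (Gamma0b G ?y) + D1 \<tau> \<mu> (Gamma1b G ?y))
            - (D0 \<tau> \<mu> (Gamma0b G ?z) + D1 \<tau> \<mu> (Gamma1b G ?z))"
          using K by (simp add: d operators_diff[OF _ csubspace_UNIV] operators_diff[OF _ bmap_Hb[OF G]])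
        also have "\<dots> = 0" using Y Z that by (simp add: is_v_tau_def)
        finally show ?thesis .
      qed
    qed
    then have "Y (lend S) h = Z (lend S) h" using ivl_lend[OF S] by simp
    then show "m_of_solution S V Z h = m_of_solution S V Y h"
      by (simp add: m_of_solution_def Gamma0ha_def Gamma0a_def Gammaha_def)
  qed
  note uniq_value = this
  show ?thesis
    unfolding m_fun_def
  proof (rule the_equality)
    show "\<exists>Z. is_v_tau S V G \<tau> \<mu> Z \<and> m_of_solution S V Y = m_of_solution S V Z"
      by (intro exI[of _ Y] conjI Y refl)
    show "M = m_of_solution S V Y" if "\<exists>Z. is_v_tau S V G \<tau> \<mu> Z \<and> M = m_of_solution S V Z" for M
      using that uniq_value by (elim exE conjE) simp
  qed
qed

section \<open>The formula for the m-function\<close>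

theorem theorem5p5:
  fixes S :: "('h::fd_chilbert, 'k::fd_chilbert) sym_sys"
    and U :: "('h, 'k) HH \<Rightarrow> 'k \<times> 'h"
    and V :: "('h, 'k) HH \<Rightarrow> ('h, 'k) HH"
    and G :: "('h, 'k, 'b::fd_chilbert) bmap"
    and v0 :: "complex \<Rightarrow> real \<Rightarrow> 'h \<times> 'k \<Rightarrow> ('h, 'k) HH"
    and u_plus :: "complex \<Rightarrow> real \<Rightarrow> 'b \<Rightarrow> ('h, 'k) HH"
    and m0 :: "complex \<Rightarrow> 'h \<times> 'k \<Rightarrow> 'h \<times> 'k"
    and M2 :: "complex \<Rightarrow> 'b \<Rightarrow> 'h \<times> 'k"
    and M3 :: "complex \<Rightarrow> 'h \<times> 'k \<Rightarrow> 'b"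
    and M4 :: "complex \<Rightarrow> 'b \<Rightarrow> 'b"
  assumes "symmetric_system S" and "definite_system S"
    and "n_minus S \<le> n_plus S"
    and "boundary_operators_a U V"
    and "boundary_map_b S G"
    and "\<And>\<mu>. Im \<mu> \<noteq> 0 \<Longrightarrow> is_v0 S V G \<mu> (v0 \<mu>)"
    and "\<And>\<mu>. Im \<mu> > 0 \<Longrightarrow> is_u_plus S V G \<mu> (u_plus \<mu>)"
    and "\<And>\<mu>. Im \<mu> \<noteq> 0 \<Longrightarrow> m0 \<mu> = m_of_solution S V (v0 \<mu>)"
    and "\<And>\<mu>. Im \<mu> > 0 \<Longrightarrow> M2 \<mu> = Gamma0ha S V (u_plus \<mu>)"
    and "\<And>\<mu>. Im \<mu> > 0 \<Longrightarrow> M3 \<mu> = (\<lambda>h. - Gamma1b G (\<lambda>t. v0 \<mu> t h))"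
    and "\<And>\<mu>. Im \<mu> > 0 \<Longrightarrow> M4 \<mu> = (\<lambda>x. - Gamma1b G (\<lambda>t. u_plus \<mu> t x))"
  shows "boundary_param (Hb G) (tau0 (Hb G))
    \<and> (\<forall>\<mu>. Im \<mu> \<noteq> 0 \<longrightarrow> m0 \<mu> = m_fun S V G (tau0 (Hb G)) \<mu>)
    \<and> (\<forall>\<tau>. boundary_param (Hb G) \<tau> \<longrightarrow>
        (\<forall>\<mu>. Im \<mu> > 0 \<longrightarrow>
          boundedly_invertible UNIV UNIV (\<lambda>x. C0 \<tau> \<mu> x - C1 \<tau> \<mu> (M4 \<mu> x))
          \<and> m_fun S V G \<tau> \<mu> =
              (\<lambda>h. m0 \<mu> h
                 + M2 \<mu> (inv (\<lambda>x. C0 \<tau> \<mu> x - C1 \<tau> \<mu> (M4 \<mu> x)) (C1 \<tau> \<mu> (M3 \<mu> h))))))"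
proof -
  note S = assms(1) and def = assms(2) and V = assms(4) and G = assms(5)
  note K = bmap_Hb[OF G]
  note tau0 = boundary_param_tau0[OF K]
  note hom = homogeneous_problem[OF S def V G]
  \<comment> \<open>Homogeneous solutions vanish for every boundary parameter in the upper half-plane.\<close>
  have homC: "\<forall>t\<in>ivl S. y t = 0"
    if \<tau>: "boundary_param (Hb G) \<tau>" and \<mu>: "Im \<mu> > 0" and y: "y \<in> L2_solutions S \<mu>"
      and a: "Gamma1a S V y = 0" "Gammaha S V y = Gammahb G y"
      and b: "C0 \<tau> \<mu> (Gamma0b G y) + C1 \<tau> \<mu> (Gamma1b G y) = 0" for \<tau> \<mu> y
  proof (rule hom[OF _ y a])
    show "Im \<mu> * (2 * Im (cinner (Gamma0b G y) (Gamma1b G y))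
      + (norm (cproj (orth (Hb G)) (Gamma0b G y)))\<^sup>2) \<le> 0"
      using boundary_param_dissipative[OF K \<tau> \<mu> bmap_mem[OF G L2_solutions_dom_Tmax[OF S y]] b] \<mu>
      by (simp add: mult_le_0_iff)
  qed (use \<mu> in simp)
  have part2: "m0 \<mu> = m_fun S V G (tau0 (Hb G)) \<mu>" if \<mu>: "Im \<mu> \<noteq> 0" for \<mu>
  proof -
    have "is_v_tau S V G (tau0 (Hb G)) \<mu> (v0 \<mu>)"
      using assms(6)[OF \<mu>] by (simp add: is_v0_def is_v_tau_def tau0_def)
    then have "m_fun S V G (tau0 (Hb G)) \<mu> = m_of_solution S V (v0 \<mu>)"
    proof (rule m_fun_eqI[OF S V G tau0])
      fix y assume y: "y \<in> L2_solutions S \<mu>" and a: "Gamma1a S V y = 0" "Gammaha S V y = Gammahb G y"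
        and C: "Im \<mu> > 0 \<Longrightarrow> C0 (tau0 (Hb G)) \<mu> (Gamma0b G y) + C1 (tau0 (Hb G)) \<mu> (Gamma1b G y) = 0"
        and D: "Im \<mu> < 0 \<Longrightarrow> D0 (tau0 (Hb G)) \<mu> (Gamma0b G y) + D1 (tau0 (Hb G)) \<mu> (Gamma1b G y) = 0"
      show "\<forall>t\<in>ivl S. y t = 0"
      proof (cases "Im \<mu> > 0")
        case True
        then show ?thesis using homC[OF tau0 True y a C] by blast
      next
        case False
        then have neg: "Im \<mu> < 0" using \<mu> by simp
        then have "cproj (Hb G) (Gamma0b G y) = 0" using D by (simp add: tau0_def)
        moreover have "Gamma1b G y \<in> Hb G" by (rule bmap_mem[OF G L2_solutions_dom_Tmax[OF S y]])
        ultimately have "cinner (Gamma0b G y) (Gamma1b G y) = 0"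
          using cinner_cproj_left[OF K, of "Gamma1b G y" "Gamma0b G y"] by simp
        then show ?thesis using neg by (intro hom[OF \<mu> y a]) (simp add: mult_le_0_iff)
      qed
    qed
    then show ?thesis using assms(8)[OF \<mu>] by simp
  qed
  have part3: "boundedly_invertible UNIV UNIV (\<lambda>x. C0 \<tau> \<mu> x - C1 \<tau> \<mu> (M4 \<mu> x))
     \<and> m_fun S V G \<tau> \<mu> = (\<lambda>h. m0 \<mu> h
         + M2 \<mu> (inv (\<lambda>x. C0 \<tau> \<mu> x - C1 \<tau> \<mu> (M4 \<mu> x)) (C1 \<tau> \<mu> (M3 \<mu> h))))"
    if \<tau>: "boundary_param (Hb G) \<tau>" and \<mu>: "Im \<mu> > 0" for \<tau> \<mu>
  proof -
    have C0: "C0 \<tau> \<mu> \<in> operators UNIV UNIV" and C1: "C1 \<tau> \<mu> \<in> operators (Hb G) UNIV"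
      using \<tau> \<mu> by (auto simp: boundary_param_def)
    have v0: "L2_op_solution S \<mu> (v0 \<mu>)" "normalized_at_a S V G (v0 \<mu>)"
      "\<And>h. Gamma0b G (\<lambda>t. v0 \<mu> t h) = 0"
      using assms(6)[of \<mu>] \<mu> by (auto simp: is_v0_def)
    have u: "L2_op_solution S \<mu> (u_plus \<mu>)"
      "\<And>h. Gamma1a S V (\<lambda>t. u_plus \<mu> t h) = 0"
      "\<And>h. \<i> *\<^sub>C (Gammaha S V (\<lambda>t. u_plus \<mu> t h) - Gammahb G (\<lambda>t. u_plus \<mu> t h)) = 0"
      "\<And>h. Gamma0b G (\<lambda>t. u_plus \<mu> t h) = h"
      using assms(7)[OF \<mu>] by (auto simp: is_u_plus_def)
    have M4: "M4 \<mu> x = - Gamma1b G (\<lambda>t. u_plus \<mu> t x)" for x using assms(11)[OF \<mu>] by simp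
    have M3: "M3 \<mu> h = - Gamma1b G (\<lambda>t. v0 \<mu> t h)" for h using assms(10)[OF \<mu>] by simp
    note Gu = Gamma1b_operators[OF S G u(1)] and Gv = Gamma1b_operators[OF S G v0(1)]
    have M4op: "M4 \<mu> \<in> operators UNIV (Hb G)"
      using Gu csubspace_minus[OF K] by (auto simp: operators_def M4 scaleC_minus_right)
    have M3op: "M3 \<mu> \<in> operators UNIV (Hb G)"
      using Gv csubspace_minus[OF K] by (auto simp: operators_def M3 scaleC_minus_right)
    define R where "R = (\<lambda>x. C0 \<tau> \<mu> x - C1 \<tau> \<mu> (M4 \<mu> x))"
    have Rop: "R \<in> operators UNIV UNIV"
      using operatorsD(1)[OF M4op]
      by (auto simp: operators_def[of UNIV UNIV] R_def operatorsD(2,3)[OF C0] operatorsD(2,3)[OF C1]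
          operatorsD(2,3)[OF M4op] scaleC_diff_right)
    have u_coupled: "Gammaha S V (\<lambda>t. u_plus \<mu> t h) = Gammahb G (\<lambda>t. u_plus \<mu> t h)" for h
      using arg_cong[OF u(3)[of h], of norm] by (simp add: norm_scaleC)
    have bij: "bij R"
    proof (rule injective_operator_surjective[OF Rop])
      fix x assume "R x = 0"
      let ?y = "\<lambda>t. u_plus \<mu> t x"
      have y: "?y \<in> L2_solutions S \<mu>" by (rule L2_op_solutionD(2)[OF u(1)])
      note mem = bmap_mem[OF G L2_solutions_dom_Tmax[OF S y]]
      have "C1 \<tau> \<mu> (Gamma1b G ?y) = - C1 \<tau> \<mu> (M4 \<mu> x)"
        using operators_scaleC[OF C1 mem, of "- 1"] by (simp add: M4 scaleC_neg1)
      then have "C0 \<tau> \<mu> (Gamma0b G ?y) + C1 \<tau> \<mu> (Gamma1b G ?y) = 0"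
        using \<open>R x = 0\<close> by (simp add: R_def u(4))
      from homC[OF \<tau> \<mu> y u(2) u_coupled this]
      have "Gamma0b G ?y = 0" using bmap_eq_0[OF S G L2_solutions_dom_Tmax[OF S y]] by blast
      then show "x = 0" by (simp add: u(4))
    qed
    define X where "X = (\<lambda>h. inv R (C1 \<tau> \<mu> (M3 \<mu> h)))"
    have RX: "R (X h) = C1 \<tau> \<mu> (M3 \<mu> h)" for h
      unfolding X_def by (rule surj_f_inv_f[OF bij_is_surj[OF bij]])
    have inj: "R x = R y \<Longrightarrow> x = y" for x y using bij by (auto simp: bij_def inj_def)
    have M3K: "M3 \<mu> h \<in> Hb G" for h using operatorsD(1)[OF M3op] by simp
    note lin = RX operatorsD(2,3)[OF Rop] operatorsD(2,3)[OF M3op] operatorsD(2,3)[OF C1] M3K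
    have "X (g + h) = X g + X h" for g h by (rule inj) (simp add: lin)
    moreover have "X (c *\<^sub>C h) = c *\<^sub>C X h" for c h by (rule inj) (simp add: lin)
    ultimately have Xop: "X \<in> operators UNIV UNIV" unfolding operators_def by blast
    \<comment> \<open>\<open>X h\<close> is the value of \<open>Gamma0b\<close> that makes the correction by \<open>u_plus\<close> satisfy the condition at \<open>b\<close>.\<close>
    define Y where "Y = (\<lambda>t h. v0 \<mu> t h + u_plus \<mu> t (X h))"
    have solv: "(\<lambda>t. v0 \<mu> t h) \<in> L2_solutions S \<mu>" and solu: "(\<lambda>t. u_plus \<mu> t x) \<in> L2_solutions S \<mu>" for h x
      by (rule L2_op_solutionD(2)[OF v0(1)], rule L2_op_solutionD(2)[OF u(1)])
    have \<Gamma>: "Gamma0b G (\<lambda>t. Y t h) = X h"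
      "Gammahb G (\<lambda>t. Y t h) = Gammahb G (\<lambda>t. v0 \<mu> t h) + Gammahb G (\<lambda>t. u_plus \<mu> t (X h))"
      "Gamma1b G (\<lambda>t. Y t h) = - M3 \<mu> h - M4 \<mu> (X h)" for h
      using bmap_add[OF G L2_solutions_dom_Tmax[OF S solv[of h]] L2_solutions_dom_Tmax[OF S solu[of "X h"]]]
      by (auto simp: Y_def v0(3) u(4) M3 M4)
    have Vadd: "V (Y (lend S) h) = V (v0 \<mu> (lend S) h) + V (u_plus \<mu> (lend S) (X h))" for h
      using operators_add[OF boundary_operators_aD(1)[OF V]] by (simp add: Y_def)
    have sol: "L2_op_solution S \<mu> Y"
      unfolding L2_op_solution_def
    proof (intro conjI ballI allI)
      fix t assume t: "t \<in> ivl S"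
      note v = operatorsD(2,3)[OF L2_op_solutionD(1)[OF v0(1) t]]
      note u = operatorsD(2,3)[OF L2_op_solutionD(1)[OF u(1) t]]
      show "Y t \<in> operators UNIV UNIV"
        unfolding operators_def Y_def
        by (intro CollectI conjI ballI allI)
           (simp_all add: v u operatorsD(2,3)[OF Xop] scaleC_add_right)
    next
      fix h
      show "(\<lambda>t. Y t h) \<in> L2_fun S" "solves_E S \<mu> (\<lambda>t. Y t h)"
        using L2_solutions_add[OF S solv[of h] solu[of "X h"]] by (auto simp: Y_def L2_solutions_def)
    qed
    have "is_v_tau S V G \<tau> \<mu> Y"
      unfolding is_v_tau_def
    proof (intro conjI impI allI, rule sol)
      show "normalized_at_a S V G Y"
        unfolding normalized_at_a_def
      proof
        fix h
        have "Gamma1a S V (\<lambda>t. Y t h) = - fst h"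
          using v0(2) u(2)[of "X h"] by (simp add: normalized_at_a_def Gamma1a_def Vadd)
        moreover have "Gammaha S V (\<lambda>t. Y t h) - Gammahb G (\<lambda>t. Y t h)
            = Gammaha S V (\<lambda>t. v0 \<mu> t h) - Gammahb G (\<lambda>t. v0 \<mu> t h)"
          using u_coupled[of "X h"] by (simp add: Gammaha_def Vadd \<Gamma>(2))
        ultimately show "Gamma1a S V (\<lambda>t. Y t h) = - fst h
            \<and> \<i> *\<^sub>C (Gammaha S V (\<lambda>t. Y t h) - Gammahb G (\<lambda>t. Y t h)) = snd h"
          using v0(2) by (simp add: normalized_at_a_def)
      qed
      fix h
      have "C1 \<tau> \<mu> (- M3 \<mu> h - M4 \<mu> (X h)) = - C1 \<tau> \<mu> (M3 \<mu> h) - C1 \<tau> \<mu> (M4 \<mu> (X h))"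
        using operators_diff[OF C1 K csubspace_minus[OF K M3K[of h]] operatorsD(1)[OF M4op, of "X h"]]
          operators_scaleC[OF C1 M3K[of h], of "- 1"] by (simp add: scaleC_neg1)
      then show "C0 \<tau> \<mu> (Gamma0b G (\<lambda>t. Y t h)) + C1 \<tau> \<mu> (Gamma1b G (\<lambda>t. Y t h)) = 0"
        using RX[of h] by (simp add: \<Gamma> R_def algebra_simps)
    qed (use \<mu> in auto)
    then have "m_fun S V G \<tau> \<mu> = m_of_solution S V Y"
      by (rule m_fun_eqI[OF S V G \<tau>]) (use homC[OF \<tau> \<mu>] \<mu> in blast)
    also have "\<dots> = (\<lambda>h. m0 \<mu> h + M2 \<mu> (X h))"
      using assms(8)[of \<mu>] assms(9)[of \<mu>] \<mu>
      by (auto simp: m_of_solution_def Gamma0ha_def Gamma0a_def Gammaha_def Vadd fun_eq_iff)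
    finally show ?thesis
      using bij by (simp add: boundedly_invertible_def R_def[symmetric] X_def)
  qed
  show ?thesis using tau0 part2 part3 by blast
qed

end
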